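(* Let $1\leq k\leq n$ be integers and let $A\in \mathrm{Sp}(n)$. Then there exist integers $p,q,r,p'\geq 0$ with $p\geq 2k-n$, $p+q+r=k$ and $p'+q+r=n-k$, real numbers $\theta_1,\dots,\theta_q\in\,]0,\pi/2[$, and matrices $a,b\in\mathrm{Sp}(k)$, $m,\ell\in\mathrm{Sp}(n-k)$, such that $$A=\begin{bmatrix}\alpha & T\\ \beta & P\end{bmatrix}$$ with $$\alpha=m\begin{bmatrix} I_{p'}&0&0\\ 0&\mathrm{diag}(\cos\theta_i)_{q\times q}&0\\ 0&0&0_r\end{bmatrix}\ell^*,\qquad T=m\begin{bmatrix}0_{p'\times p}&0&0\\ 0&-\mathrm{diag}(\sin\theta_i)_{q\times q}&0\\ 0&0&-I_r\end{bmatrix}b^*,$$ $$\beta=a\begin{bmatrix}0_{p\times p'}&0&0\\ 0&\mathrm{diag}(\sin\theta_i)_{q\times q}&0\\ 0&0&I_r\end{bmatrix}\ell^*,\qquad P=a\begin{bmatrix}I_p&0&0\\ 0&\mathrm{diag}(\cos\theta_i)_{q\times q}&0\\ 0&0&0_r\end{bmatrix}b^*.$$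
   Context: $\mathbb{H}$ denotes the quaternions and $M^*$ the conjugate transpose of a quaternionic matrix $M$. $\mathrm{Sp}(n)$ is the group of matrices $A\in\mathbb{H}^{n\times n}$ with $AA^*=I_n$ (with $\mathrm{Sp}(0)$ trivial). In the block form of $A$, the sizes are $\alpha\in\mathbb{H}^{(n-k)\times(n-k)}$, $T\in\mathbb{H}^{(n-k)\times k}$, $\beta\in\mathbb{H}^{k\times(n-k)}$, $P\in\mathbb{H}^{k\times k}$. $\mathrm{diag}(t_i)_{q\times q}$ is the $q\times q$ diagonal matrix with diagonal entries $t_1,\dots,t_q$; $I_p$ is the $p\times p$ identity matrix; $0_r$ is the $r\times r$ zero matrix and $0_{p'\times p}$ is the $p'\times p$ zero matrix. Blocks of size zero are allowed (and are then absent). *)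

theory Defs
  imports Complex_Main "Jordan_Normal_Form.Matrix"
begin

datatype quat = Quat (qre: real) (qim1: real) (qim2: real) (qim3: real)

lemma quat_eq_iff:
  "x = y \<longleftrightarrow> qre x = qre y \<and> qim1 x = qim1 y \<and> qim2 x = qim2 y \<and> qim3 x = qim3 y"
  by (cases x; cases y) simp

(* The product is determined by i^2 = j^2 = k^2 = ijk = -1, where
   Quat a b c d stands for a + b i + c j + d k. *)
instantiation quat :: real_div_algebra
begin

definition zero_quat :: quat where "0 = Quat 0 0 0 0"

definition one_quat :: quat where "1 = Quat 1 0 0 0"

definition plus_quat :: "quat \<Rightarrow> quat \<Rightarrow> quat" where
  "x + y = Quat (qre x + qre y) (qim1 x + qim1 y) (qim2 x + qim2 y) (qim3 x + qim3 y)"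

definition uminus_quat :: "quat \<Rightarrow> quat" where
  "- x = Quat (- qre x) (- qim1 x) (- qim2 x) (- qim3 x)"

definition minus_quat :: "quat \<Rightarrow> quat \<Rightarrow> quat" where
  "x - y = Quat (qre x - qre y) (qim1 x - qim1 y) (qim2 x - qim2 y) (qim3 x - qim3 y)"

definition times_quat :: "quat \<Rightarrow> quat \<Rightarrow> quat" where
  "x * y = Quat
     (qre x * qre y - qim1 x * qim1 y - qim2 x * qim2 y - qim3 x * qim3 y)
     (qre x * qim1 y + qim1 x * qre y + qim2 x * qim3 y - qim3 x * qim2 y)
     (qre x * qim2 y - qim1 x * qim3 y + qim2 x * qre y + qim3 x * qim1 y)
     (qre x * qim3 y + qim1 x * qim2 y - qim2 x * qim1 y + qim3 x * qre y)"

definition scaleR_quat :: "real \<Rightarrow> quat \<Rightarrow> quat" where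
  "scaleR c x = Quat (c * qre x) (c * qim1 x) (c * qim2 x) (c * qim3 x)"

definition inverse_quat :: "quat \<Rightarrow> quat" where
  "inverse x = scaleR (inverse ((qre x)\<^sup>2 + (qim1 x)\<^sup>2 + (qim2 x)\<^sup>2 + (qim3 x)\<^sup>2))
     (Quat (qre x) (- qim1 x) (- qim2 x) (- qim3 x))"

definition divide_quat :: "quat \<Rightarrow> quat \<Rightarrow> quat" where
  "divide x (y :: quat) = x * inverse y"

instance
proof
  fix x y z :: quat and c d :: real
  have nz: "(qre x)\<^sup>2 + (qim1 x)\<^sup>2 + (qim2 x)\<^sup>2 + (qim3 x)\<^sup>2 \<noteq> 0" if "x \<noteq> 0"
  proof
    assume "(qre x)\<^sup>2 + (qim1 x)\<^sup>2 + (qim2 x)\<^sup>2 + (qim3 x)\<^sup>2 = 0"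
    then have "(qre x)\<^sup>2 = 0 \<and> (qim1 x)\<^sup>2 = 0 \<and> (qim2 x)\<^sup>2 = 0 \<and> (qim3 x)\<^sup>2 = 0"
      using zero_le_power2[of "qre x"] zero_le_power2[of "qim1 x"]
        zero_le_power2[of "qim2 x"] zero_le_power2[of "qim3 x"] by linarith
    with that show False
      by (simp add: zero_quat_def quat_eq_iff)
  qed
  have l: "scaleR (inverse s) u * w = scaleR (inverse s) (u * w)"
    and r: "w * scaleR (inverse s) u = scaleR (inverse s) (w * u)" for s and u w :: quat
    by (simp_all add: times_quat_def scaleR_quat_def algebra_simps)
  have n: "Quat (qre x) (- qim1 x) (- qim2 x) (- qim3 x) * x =
           Quat ((qre x)\<^sup>2 + (qim1 x)\<^sup>2 + (qim2 x)\<^sup>2 + (qim3 x)\<^sup>2) 0 0 0"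
          "x * Quat (qre x) (- qim1 x) (- qim2 x) (- qim3 x) =
           Quat ((qre x)\<^sup>2 + (qim1 x)\<^sup>2 + (qim2 x)\<^sup>2 + (qim3 x)\<^sup>2) 0 0 0"
    by (simp_all add: times_quat_def power2_eq_square)
  show "inverse x * x = 1" if "x \<noteq> 0"
    unfolding inverse_quat_def l n using nz[OF that]
    by (simp add: scaleR_quat_def one_quat_def)
  show "x * inverse x = 1" if "x \<noteq> 0"
    unfolding inverse_quat_def r n using nz[OF that]
    by (simp add: scaleR_quat_def one_quat_def)
  show "inverse (0 :: quat) = 0"
    by (simp add: inverse_quat_def zero_quat_def scaleR_quat_def)
qed (simp_all add: zero_quat_def one_quat_def plus_quat_def uminus_quat_def minus_quat_def
       times_quat_def scaleR_quat_def divide_quat_def quat_eq_iff algebra_simps)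

end

definition quat_cnj :: "quat \<Rightarrow> quat" where
  "quat_cnj x = Quat (qre x) (- qim1 x) (- qim2 x) (- qim3 x)"

(* The adjoint of Schur_Decomposition is restricted to fields, and conjugatable_ring
   demands a multiplicative conjugation, whereas quat_cnj reverses products. *)
definition conj_transpose :: "quat mat \<Rightarrow> quat mat" where
  "conj_transpose M = transpose_mat (map_mat quat_cnj M)"

definition Sp :: "nat \<Rightarrow> quat mat set" where
  "Sp n = {A \<in> carrier_mat n n. A * conj_transpose A = 1\<^sub>m n}"

end

theory Submission
  imports Defs "HOL-Analysis.Function_Topology"
begin

text \<open>
  This is the cosine-sine decomposition of a quaternionic unitary matrix, split into four
  blocks \<open>\<alpha>\<close>, \<open>T\<close>, \<open>\<beta>\<close>, \<open>P\<close>. It is proved by splitting off one plane rotation at a time,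
  by induction on the size \<open>k\<close> of \<open>P\<close>.

  If \<open>T = 0\<close>, then unitarity forces \<open>\<beta> = 0\<close>, so \<open>\<alpha>\<close> and \<open>P\<close> are themselves unitary and there
  is no rotation at all (\<open>cs_form_of_zero_corner\<close>). Otherwise let \<open>x\<close> be a unit column that
  maximises the norm of \<open>T x\<close>, and let \<open>sin t\<close> be the maximum. Maximality makes \<open>x\<close> an
  eigenvector of \<open>T\<^sup>\<dagger> T\<close>, and the orthogonality relations between the blocks then
  produce unit columns \<open>w\<close>, \<open>y\<close>, \<open>z\<close> such that \<open>A\<close> maps the plane spanned by \<open>(w, 0)\<close> and
  \<open>(0, x)\<close> onto the plane spanned by \<open>(z, 0)\<close> and \<open>(0, y)\<close> by a rotation of angle \<open>t\<close>, and
  the adjoint of \<open>A\<close> maps it back (\<open>exists_cs_vectors\<close>). Completing the four columns to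
  orthonormal bases and restricting \<open>A\<close> to the orthogonal complements of these planes gives a
  unitary matrix of smaller size (\<open>compress_unitary_blocks\<close>), to which the induction
  hypothesis applies; the rotation is put back as a last diagonal entry of the four middle
  factors (\<open>cs_form_extend\<close>).

  The required order of the diagonal entries comes for free. An angle \<open>\<pi>/2\<close> may always be
  appended at the end. If \<open>t < \<pi>/2\<close>, then, as \<open>sin t\<close> is maximal, \<open>P\<close> is injective,
  and this property passes to the smaller problem, where it excludes angles \<open>\<pi>/2\<close>.
  Hence it is carried along in the induction (\<open>cs_form_exists\<close>), and with the convention that
  the last \<open>r\<close> angles are \<open>\<pi>/2\<close> the blocks \<open>0\<close> and \<open>\<plusminus>I\<close> of size \<open>r\<close> are diagonal
  matrices of cosines and sines like the others. The inequality for \<open>p\<close> is a consequence of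
  the two size equations, since they give \<open>p = 2 k - n + p'\<close>.

  Three facts about quaternionic matrices are needed. A one-sided inverse of a
  square matrix is two-sided, and a square matrix with singular adjoint is singular; both
  follow, over any division ring, from the existence of nontrivial solutions of
  underdetermined homogeneous systems. The maximum exists because the unit sphere is compact;
  this is checked in real coordinates with the product topology on functions.
\<close>

(* Column matrices have type n x 1; rewriting this 1 to Suc 0 would hide the carrier facts. *)
declare One_nat_def [simp del]

notation conj_transpose ("(_\<^sup>\<dagger>)" [1000] 999)

section \<open>Quaternion arithmetic in coordinates\<close>

lemma quat_sel [simp]:
  "qre 0 = 0" "qim1 0 = 0" "qim2 0 = 0" "qim3 0 = 0"
  "qre 1 = 1" "qim1 1 = 0" "qim2 1 = 0" "qim3 1 = 0"
  "qre (x + y) = qre x + qre y" "qim1 (x + y) = qim1 x + qim1 y"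
  "qim2 (x + y) = qim2 x + qim2 y" "qim3 (x + y) = qim3 x + qim3 y"
  "qre (x - y) = qre x - qre y" "qim1 (x - y) = qim1 x - qim1 y"
  "qim2 (x - y) = qim2 x - qim2 y" "qim3 (x - y) = qim3 x - qim3 y"
  "qre (- x) = - qre x" "qim1 (- x) = - qim1 x" "qim2 (- x) = - qim2 x" "qim3 (- x) = - qim3 x"
  "qre (of_real r) = r" "qim1 (of_real r) = 0" "qim2 (of_real r) = 0" "qim3 (of_real r) = 0"
  "qre (quat_cnj x) = qre x" "qim1 (quat_cnj x) = - qim1 x"
  "qim2 (quat_cnj x) = - qim2 x" "qim3 (quat_cnj x) = - qim3 x"
  by (simp_all add: zero_quat_def one_quat_def plus_quat_def minus_quat_def uminus_quat_def
      of_real_def scaleR_quat_def quat_cnj_def)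

lemma quat_sel_times:
  "qre (x * y) = qre x * qre y - qim1 x * qim1 y - qim2 x * qim2 y - qim3 x * qim3 y"
  "qim1 (x * y) = qre x * qim1 y + qim1 x * qre y + qim2 x * qim3 y - qim3 x * qim2 y"
  "qim2 (x * y) = qre x * qim2 y - qim1 x * qim3 y + qim2 x * qre y + qim3 x * qim1 y"
  "qim3 (x * y) = qre x * qim3 y + qim1 x * qim2 y - qim2 x * qim1 y + qim3 x * qre y"
  by (simp_all add: times_quat_def)

lemma quat_sel_sum:
  "qre (sum f S) = (\<Sum>i\<in>S. qre (f i))" "qim1 (sum f S) = (\<Sum>i\<in>S. qim1 (f i))"
  "qim2 (sum f S) = (\<Sum>i\<in>S. qim2 (f i))" "qim3 (sum f S) = (\<Sum>i\<in>S. qim3 (f i))"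
  by (induction S rule: infinite_finite_induct; simp)+

lemma of_real_quat_commute: "x * (of_real r :: quat) = of_real r * x"
  by (simp add: quat_eq_iff quat_sel_times)

lemma quat_cnj_simps [simp]:
  "quat_cnj (quat_cnj x) = x" "quat_cnj 0 = 0" "quat_cnj 1 = 1"
  "quat_cnj (of_real r) = of_real r" "quat_cnj (x + y) = quat_cnj x + quat_cnj y"
  "quat_cnj (x - y) = quat_cnj x - quat_cnj y" "quat_cnj (- x) = - quat_cnj x"
  by (simp_all add: quat_eq_iff)

lemma quat_cnj_mult: "quat_cnj (x * y) = quat_cnj y * quat_cnj x"
  by (simp add: quat_eq_iff quat_sel_times)

lemma quat_cnj_sum: "quat_cnj (sum f S) = (\<Sum>i\<in>S. quat_cnj (f i))"
  by (simp add: quat_eq_iff quat_sel_sum sum_negf)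

lemma quat_cnj_times_self:
  "quat_cnj x * x = of_real ((qre x)\<^sup>2 + (qim1 x)\<^sup>2 + (qim2 x)\<^sup>2 + (qim3 x)\<^sup>2)"
  by (simp add: quat_eq_iff quat_sel_times power2_eq_square)

section \<open>Matrix algebra\<close>

text \<open>
  The laws of matrix algebra are stated with dimension equations instead of carrier sets:
  the conditions then contain no variables beyond those of the matrices, so that the
  simplifier can discharge them and \<open>mat_algebra\<close> normalises products of many rectangular
  factors.
\<close>

lemma mat_mult_assoc:
  "dim_col A = dim_row B \<Longrightarrow> dim_col B = dim_row C \<Longrightarrow> A * B * C = A * (B * C :: 'a :: semiring_0 mat)"
  by (rule assoc_mult_mat[of _ "dim_row A" "dim_col A" _ "dim_col B" _ "dim_col C"]) auto

lemma mat_add_mult_distrib: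
  "dim_row A = dim_row B \<Longrightarrow> dim_col A = dim_col B \<Longrightarrow> dim_col B = dim_row C \<Longrightarrow>
   (A + B) * C = A * C + B * (C :: 'a :: semiring_0 mat)"
  by (rule add_mult_distrib_mat[of _ "dim_row A" "dim_col A" _ _ "dim_col C"]) auto

lemma mat_mult_add_distrib:
  "dim_row B = dim_row C \<Longrightarrow> dim_col B = dim_col C \<Longrightarrow> dim_col A = dim_row B \<Longrightarrow>
   A * (B + C) = A * B + A * (C :: 'a :: semiring_0 mat)"
  by (rule mult_add_distrib_mat[of _ "dim_row A" "dim_col A" _ "dim_col C"]) auto

lemma mat_smult_mult:
  "dim_col A = dim_row B \<Longrightarrow> (c \<cdot>\<^sub>m A) * B = c \<cdot>\<^sub>m (A * B :: 'a :: semiring_0 mat)"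
  by (rule eq_matI) (auto simp: scalar_prod_def sum_distrib_left mult.assoc)

text \<open>
  A scalar can be moved past a left factor only when it is central; for quaternions this
  is used with real scalars.
\<close>

lemma mat_mult_smult_central:
  fixes A B :: "'a :: semiring_0 mat"
  assumes c: "\<And>x. x * c = c * x" and "dim_col A = dim_row B"
  shows "A * (c \<cdot>\<^sub>m B) = c \<cdot>\<^sub>m (A * B)"
proof -
  have "x * (c * y) = c * (x * y)" for x y
    by (simp only: mult.assoc[symmetric] c)
  then show ?thesis
    using assms(2) by (intro eq_matI) (auto simp: scalar_prod_def sum_distrib_left)
qed

lemmas mat_mult_smult_of_real = mat_mult_smult_central[OF of_real_quat_commute]

lemma smult_smult_mat: "c \<cdot>\<^sub>m (d \<cdot>\<^sub>m A) = (c * d :: 'a :: semigroup_mult) \<cdot>\<^sub>m A"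
  by (rule eq_matI) (auto simp: mult.assoc)

lemma one_smult_mat [simp]: "(1 :: 'a :: monoid_mult) \<cdot>\<^sub>m A = A"
  by (rule eq_matI) auto

lemma mat_add_zero [simp]:
  fixes A :: "'a :: monoid_add mat"
  assumes "dim_row A = n" "dim_col A = m"
  shows "A + 0\<^sub>m n m = A" "0\<^sub>m n m + A = A"
  using assms by (auto intro!: eq_matI)

lemma conj_transpose_dim [simp]:
  "dim_row (A\<^sup>\<dagger>) = dim_col A" "dim_col (A\<^sup>\<dagger>) = dim_row A"
  "A\<^sup>\<dagger> \<in> carrier_mat n m \<longleftrightarrow> A \<in> carrier_mat m n"
  by (simp_all add: conj_transpose_def)

lemma conj_transpose_index [simp]:
  "i < dim_col A \<Longrightarrow> j < dim_row A \<Longrightarrow> A\<^sup>\<dagger> $$ (i, j) = quat_cnj (A $$ (j, i))"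
  by (simp add: conj_transpose_def)

lemma conj_transpose_simps [simp]:
  "(A\<^sup>\<dagger>)\<^sup>\<dagger> = A" "(1\<^sub>m n)\<^sup>\<dagger> = 1\<^sub>m n" "(0\<^sub>m n m)\<^sup>\<dagger> = 0\<^sub>m m n"
  by (rule eq_matI; simp)+

lemma conj_transpose_smult_of_real: "(of_real c \<cdot>\<^sub>m A)\<^sup>\<dagger> = of_real c \<cdot>\<^sub>m A\<^sup>\<dagger>"
  by (rule eq_matI) (auto simp: quat_cnj_mult of_real_quat_commute)

lemma conj_transpose_add:
  "dim_row A = dim_row B \<Longrightarrow> dim_col A = dim_col B \<Longrightarrow> (A + B)\<^sup>\<dagger> = A\<^sup>\<dagger> + B\<^sup>\<dagger>"
  by (rule eq_matI) auto

lemma conj_transpose_mult: "dim_col A = dim_row B \<Longrightarrow> (A * B)\<^sup>\<dagger> = B\<^sup>\<dagger> * A\<^sup>\<dagger>"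
  by (rule eq_matI) (auto simp: scalar_prod_def quat_cnj_sum quat_cnj_mult)

lemma conj_transpose_four_block:
  assumes "A \<in> carrier_mat n1 m1" "B \<in> carrier_mat n1 m2"
    "C \<in> carrier_mat n2 m1" "D \<in> carrier_mat n2 m2"
  shows "(four_block_mat A B C D)\<^sup>\<dagger> = four_block_mat (A\<^sup>\<dagger>) (C\<^sup>\<dagger>) (B\<^sup>\<dagger>) (D\<^sup>\<dagger>)"
  by (rule eq_matI, insert assms, auto)

lemmas mat_algebra = mat_mult_assoc mat_add_mult_distrib mat_mult_add_distrib
  mat_smult_mult mat_mult_smult_of_real smult_smult_mat
  conj_transpose_add conj_transpose_mult conj_transpose_smult_of_real

section \<open>Linear systems over a division ring\<close>

text \<open>
  Gaussian elimination: if the last equation is not trivial, some unknown \<open>k\<close> has an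
  invertible coefficient there and can be expressed by the others, which leaves one
  equation and one unknown less. The coefficients multiply the unknowns from the left, so
  the elimination also works without commutativity.
\<close>

lemma underdetermined_system_nontrivial_solution:
  fixes f :: "nat \<Rightarrow> 'b \<Rightarrow> 'a :: division_ring"
  assumes "finite J" "m < card J"
  shows "\<exists>x. (\<exists>j\<in>J. x j \<noteq> 0) \<and> (\<forall>i<m. (\<Sum>j\<in>J. f i j * x j) = 0)"
  using assms
proof (induction m arbitrary: f J)
  case 0
  then obtain j where "j \<in> J" by fastforce
  then show ?case by (intro exI[of _ "\<lambda>_. 1"]) auto
next
  case (Suc m)
  show ?case
  proof (cases "\<forall>j\<in>J. f m j = 0")
    case True
    obtain x where x: "\<exists>j\<in>J. x j \<noteq> 0" "\<forall>i<m. (\<Sum>j\<in>J. f i j * x j) = 0"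
      using Suc.IH[of J f] Suc.prems by auto
    moreover have "(\<Sum>j\<in>J. f m j * x j) = 0"
      using True by (simp add: sum.neutral)
    ultimately show ?thesis
      by (intro exI[of _ x]) (auto simp: less_Suc_eq)
  next
    case False
    then obtain k where k: "k \<in> J" "f m k \<noteq> 0" by auto
    let ?J = "J - {k}"
    \<comment> \<open>The coefficients after substituting the value of the unknown \<open>k\<close>.\<close>
    define g where "g i j = f i j - f i k * inverse (f m k) * f m j" for i j
    have "m < card ?J" using Suc.prems k by simp
    then obtain x where x: "\<exists>j\<in>?J. x j \<noteq> 0" "\<forall>i<m. (\<Sum>j\<in>?J. g i j * x j) = 0"
      using Suc.IH[of ?J g] Suc.prems(1) by auto
    define s where "s = (\<Sum>j\<in>?J. f m j * x j)"
    define y where "y = x(k := - (inverse (f m k) * s))"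
    have sum_y: "(\<Sum>j\<in>J. f i j * y j) = (\<Sum>j\<in>?J. f i j * x j) - f i k * inverse (f m k) * s" for i
    proof -
      have "(\<Sum>j\<in>J. f i j * y j) = f i k * y k + (\<Sum>j\<in>?J. f i j * y j)"
        using k Suc.prems by (intro sum.remove) auto
      also have "(\<Sum>j\<in>?J. f i j * y j) = (\<Sum>j\<in>?J. f i j * x j)"
        by (rule sum.cong) (auto simp: y_def)
      finally show ?thesis by (simp add: y_def mult.assoc)
    qed
    have "(\<Sum>j\<in>J. f i j * y j) = 0" if "i < Suc m" for i
    proof (cases "i = m")
      case True
      then show ?thesis using k unfolding sum_y by (simp add: s_def)
    next
      case False
      have "(\<Sum>j\<in>?J. g i j * x j) = (\<Sum>j\<in>J. f i j * y j)"
        unfolding sum_y s_def g_def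
        by (simp add: left_diff_distrib sum_subtractf sum_distrib_left mult.assoc)
      then show ?thesis using x(2) that False by simp
    qed
    moreover have "\<exists>j\<in>J. y j \<noteq> 0" using x(1) by (auto simp: y_def)
    ultimately show ?thesis by blast
  qed
qed

lemma index_mult_mat_of_fun:
  assumes "A \<in> carrier_mat n m" "i < n" "j < l"
  shows "(A * mat m l f) $$ (i, j) = (\<Sum>k<m. A $$ (i, k) * f (k, j))"
  using assms by (auto simp: scalar_prod_def lessThan_atLeast0)

lemma wide_matrix_kernel:
  fixes M :: "'a :: division_ring mat"
  assumes "M \<in> carrier_mat m n" "m < n"
  shows "\<exists>x \<in> carrier_mat n 1. x \<noteq> 0\<^sub>m n 1 \<and> M * x = 0\<^sub>m m 1"
proof -
  obtain x where x: "\<exists>j<n. x j \<noteq> 0" "\<forall>i<m. (\<Sum>j<n. M $$ (i, j) * x j) = 0"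
    using underdetermined_system_nontrivial_solution[of "{..<n}" m "\<lambda>i j. M $$ (i, j)"] assms
    by auto
  let ?x = "mat n 1 (\<lambda>(j, _). x j)"
  have "M * ?x = 0\<^sub>m m 1"
    by (rule eq_matI)
      (use assms(1) x(2) in \<open>auto simp: index_mult_mat_of_fun[OF assms(1)] simp del: index_mult_mat(1)\<close>)
  moreover have "?x \<noteq> 0\<^sub>m n 1"
  proof
    assume "?x = 0\<^sub>m n 1"
    then have "?x $$ (j, 0) = 0" if "j < n" for j using that by simp
    then have "x j = 0" if "j < n" for j using that by simp
    then show False using x(1) by blast
  qed
  ultimately show ?thesis by (intro bexI[of _ ?x]) auto
qed

text \<open>
  Appending a unit column to \<open>M\<close> gives a system with one more unknown than equations. In a
  nontrivial solution the additional unknown cannot vanish, by injectivity, and dividing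
  by it solves \<open>M x = e\<close> for this unit column \<open>e\<close>.
\<close>

lemma square_injective_right_inverse:
  fixes M :: "'a :: division_ring mat"
  assumes M: "M \<in> carrier_mat n n"
    and inj: "\<And>x. x \<in> carrier_mat n 1 \<Longrightarrow> M * x = 0\<^sub>m n 1 \<Longrightarrow> x = 0\<^sub>m n 1"
  shows "\<exists>R \<in> carrier_mat n n. M * R = 1\<^sub>m n"
proof -
  have "\<exists>x. \<forall>i<n. (\<Sum>j<n. M $$ (i, j) * x j) = (if i = l then 1 else 0)" for l
  proof -
    let ?f = "\<lambda>i j. if j < n then M $$ (i, j) else if i = l then 1 else 0"
    have "\<exists>y. (\<exists>j\<in>{..<Suc n}. y j \<noteq> 0) \<and> (\<forall>i<n. (\<Sum>j<Suc n. ?f i j * y j) = 0)"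
      by (rule underdetermined_system_nontrivial_solution) auto
    then obtain y where y: "\<exists>j\<in>{..<Suc n}. y j \<noteq> 0" "\<forall>i<n. (\<Sum>j<Suc n. ?f i j * y j) = 0"
      by (elim exE conjE)
    have eq: "(\<Sum>j<n. M $$ (i, j) * y j) = - ((if i = l then 1 else 0) * y n)" if "i < n" for i
      using y(2)[rule_format, OF that] by (simp add: add_eq_0_iff2)
    have "y n \<noteq> 0"
    proof
      assume yn: "y n = 0"
      let ?y = "mat n 1 (\<lambda>(j, _). y j)"
      have "M * ?y = 0\<^sub>m n 1"
        by (rule eq_matI) (use M in \<open>auto simp: index_mult_mat_of_fun[OF M] eq yn simp del: index_mult_mat(1)\<close>)
      then have "?y = 0\<^sub>m n 1" by (rule inj[rotated]) auto
      then have y0: "?y $$ (j, 0) = 0" if "j < n" for j using that by simp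
      obtain j where j: "j < Suc n" "y j \<noteq> 0" using y(1) by blast
      with yn have "j < n" by (cases "j = n") auto
      with y0[of j] j show False by simp
    qed
    have "(\<Sum>j<n. M $$ (i, j) * (y j * - inverse (y n))) = (if i = l then 1 else 0)"
      if "i < n" for i
    proof -
      have "(\<Sum>j<n. M $$ (i, j) * (y j * - inverse (y n)))
          = (\<Sum>j<n. M $$ (i, j) * y j) * - inverse (y n)"
        unfolding sum_distrib_right mult.assoc ..
      then show ?thesis using eq[OF that] \<open>y n \<noteq> 0\<close> by simp
    qed
    then show ?thesis by (intro exI[of _ "\<lambda>j. y j * - inverse (y n)"] allI impI)
  qed
  then have "\<forall>l. \<exists>x. \<forall>i<n. (\<Sum>j<n. M $$ (i, j) * x j) = (if i = l then 1 else 0)"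
    by (rule allI)
  from choice[OF this]
  obtain x where x: "\<forall>l. \<forall>i<n. (\<Sum>j<n. M $$ (i, j) * x l j) = (if i = l then 1 else 0)"
    by (rule exE)
  let ?R = "mat n n (\<lambda>(j, l). x l j)"
  have "M * ?R = 1\<^sub>m n"
    by (rule eq_matI) (use M in \<open>auto simp: index_mult_mat_of_fun[OF M] x simp del: index_mult_mat(1)\<close>)
  then show ?thesis by (intro bexI[of _ ?R]) auto
qed

text \<open>
  \<open>A B = 1\<close> makes \<open>B\<close> injective, so \<open>B\<close> has a right inverse, which can only be \<open>A\<close>.
\<close>

lemma square_right_inverse_imp_left_inverse:
  fixes A B :: "'a :: division_ring mat"
  assumes "A \<in> carrier_mat n n" "B \<in> carrier_mat n n" "A * B = 1\<^sub>m n"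
  shows "B * A = 1\<^sub>m n"
proof -
  have "\<exists>R \<in> carrier_mat n n. B * R = 1\<^sub>m n"
  proof (rule square_injective_right_inverse[OF assms(2)])
    fix x :: "'a mat" assume x: "x \<in> carrier_mat n 1" "B * x = 0\<^sub>m n 1"
    have "x = (A * B) * x" using assms x by simp
    also have "\<dots> = A * (B * x)" using assms(1,2) x(1) by (intro mat_mult_assoc) auto
    also have "\<dots> = 0\<^sub>m n 1" using assms(1) x(2) by simp
    finally show "x = 0\<^sub>m n 1" .
  qed
  then obtain R where R: "R \<in> carrier_mat n n" "B * R = 1\<^sub>m n" by auto
  have "A * B * R = A * (B * R)" using R assms(1,2) by (intro mat_mult_assoc) auto
  then have "R = A" using R assms by simp
  then show ?thesis using R by simp
qed

lemma SpD:
  assumes "A \<in> Sp n"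
  shows "A \<in> carrier_mat n n" "A * A\<^sup>\<dagger> = 1\<^sub>m n" "A\<^sup>\<dagger> * A = 1\<^sub>m n"
  using assms square_right_inverse_imp_left_inverse[of A n "A\<^sup>\<dagger>"] by (auto simp: Sp_def)

lemma SpI: "A \<in> carrier_mat n n \<Longrightarrow> A\<^sup>\<dagger> * A = 1\<^sub>m n \<Longrightarrow> A \<in> Sp n"
  using square_right_inverse_imp_left_inverse[of "A\<^sup>\<dagger>" n "A"] by (auto simp: Sp_def)

section \<open>Norms of quaternionic columns\<close>

text \<open>
  The real part of the quaternionic Hermitian form is a real inner product; it is all that
  the maximisation argument needs, and unlike the Hermitian form it is symmetric.
\<close>

definition col_inner :: "quat mat \<Rightarrow> quat mat \<Rightarrow> real" where
  "col_inner u v = qre ((u\<^sup>\<dagger> * v) $$ (0, 0))"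

abbreviation col_norm2 :: "quat mat \<Rightarrow> real" where
  "col_norm2 u \<equiv> col_inner u u"

lemma col_inner_eq_sum:
  assumes "u \<in> carrier_mat n 1" "v \<in> carrier_mat n 1"
  shows "col_inner u v = (\<Sum>i<n. qre (u $$ (i, 0)) * qre (v $$ (i, 0)) + qim1 (u $$ (i, 0)) * qim1 (v $$ (i, 0))
    + qim2 (u $$ (i, 0)) * qim2 (v $$ (i, 0)) + qim3 (u $$ (i, 0)) * qim3 (v $$ (i, 0)))"
proof -
  have "(u\<^sup>\<dagger> * v) $$ (0, 0) = (\<Sum>i<n. quat_cnj (u $$ (i, 0)) * v $$ (i, 0))"
    using assms by (auto simp: scalar_prod_def lessThan_atLeast0)
  then show ?thesis
    by (simp add: col_inner_def quat_sel_sum quat_sel_times)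
qed

lemma col_norm2_eq_sum:
  assumes "u \<in> carrier_mat n 1"
  shows "col_norm2 u = (\<Sum>i<n. (qre (u $$ (i, 0)))\<^sup>2 + (qim1 (u $$ (i, 0)))\<^sup>2
    + (qim2 (u $$ (i, 0)))\<^sup>2 + (qim3 (u $$ (i, 0)))\<^sup>2)"
  using col_inner_eq_sum[OF assms assms] by (simp add: power2_eq_square)

lemma conj_transpose_mult_self_col:
  assumes "u \<in> carrier_mat n 1"
  shows "u\<^sup>\<dagger> * u = of_real (col_norm2 u) \<cdot>\<^sub>m 1\<^sub>m 1"
proof -
  have "(u\<^sup>\<dagger> * u) $$ (0, 0) = (\<Sum>i<n. quat_cnj (u $$ (i, 0)) * u $$ (i, 0))"
    using assms by (auto simp: scalar_prod_def lessThan_atLeast0)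
  also have "\<dots> = of_real (col_norm2 u)"
    by (simp add: quat_cnj_times_self col_norm2_eq_sum[OF assms])
  finally show ?thesis
    using assms by (intro eq_matI) auto
qed

lemma unit_col_iff:
  assumes "u \<in> carrier_mat n 1"
  shows "u\<^sup>\<dagger> * u = 1\<^sub>m 1 \<longleftrightarrow> col_norm2 u = 1"
proof
  assume "u\<^sup>\<dagger> * u = 1\<^sub>m 1"
  then show "col_norm2 u = 1" by (simp add: col_inner_def)
next
  assume "col_norm2 u = 1"
  then show "u\<^sup>\<dagger> * u = 1\<^sub>m 1" by (simp add: conj_transpose_mult_self_col[OF assms])
qed

lemma col_norm2_nonneg: "u \<in> carrier_mat n 1 \<Longrightarrow> 0 \<le> col_norm2 u"
  by (simp add: col_norm2_eq_sum sum_nonneg)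

lemma col_norm2_eq_0_iff:
  assumes "u \<in> carrier_mat n 1"
  shows "col_norm2 u = 0 \<longleftrightarrow> u = 0\<^sub>m n 1"
proof
  assume 0: "col_norm2 u = 0"
  have "u $$ (i, 0) = 0" if "i < n" for i
  proof -
    have "(qre (u $$ (i, 0)))\<^sup>2 + (qim1 (u $$ (i, 0)))\<^sup>2 + (qim2 (u $$ (i, 0)))\<^sup>2 + (qim3 (u $$ (i, 0)))\<^sup>2 = 0"
      using 0 that unfolding col_norm2_eq_sum[OF assms]
      by (subst (asm) sum_nonneg_eq_0_iff) auto
    then show ?thesis
      by (simp add: quat_eq_iff add_nonneg_eq_0_iff)
  qed
  then show "u = 0\<^sub>m n 1"
    using assms by (intro eq_matI) auto
next
  assume "u = 0\<^sub>m n 1"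
  then show "col_norm2 u = 0" unfolding col_norm2_eq_sum[OF assms] by simp
qed

lemma col_norm2_smult:
  assumes "u \<in> carrier_mat n 1"
  shows "col_norm2 (of_real c \<cdot>\<^sub>m u) = c\<^sup>2 * col_norm2 u"
proof -
  have "of_real c \<cdot>\<^sub>m u \<in> carrier_mat n 1" using assms by simp
  then show ?thesis
    using assms unfolding col_norm2_eq_sum[OF assms] col_norm2_eq_sum[OF \<open>of_real c \<cdot>\<^sub>m u \<in> carrier_mat n 1\<close>]
    by (simp add: sum_distrib_left quat_sel_times power_mult_distrib distrib_left)
qed

lemma col_norm2_diff_smult:
  assumes u: "u \<in> carrier_mat n 1" and v: "v \<in> carrier_mat n 1"
  shows "col_norm2 (u - of_real c \<cdot>\<^sub>m v) = col_norm2 u - 2 * c * col_inner u v + c\<^sup>2 * col_norm2 v"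
proof -
  have w: "u - of_real c \<cdot>\<^sub>m v \<in> carrier_mat n 1"
    using v by (intro minus_carrier_mat smult_carrier_mat)
  show ?thesis
    unfolding col_norm2_eq_sum[OF w] col_norm2_eq_sum[OF u] col_norm2_eq_sum[OF v]
      col_inner_eq_sum[OF u v] sum_distrib_left sum_subtractf[symmetric] sum.distrib[symmetric]
    by (rule sum.cong) (use u v in \<open>auto simp: quat_sel_times power2_eq_square algebra_simps\<close>)
qed

lemma col_inner_adjoint:
  assumes "M \<in> carrier_mat m n" "u \<in> carrier_mat n 1" "v \<in> carrier_mat m 1"
  shows "col_inner (M * u) v = col_inner u (M\<^sup>\<dagger> * v)"
proof -
  have "(M * u)\<^sup>\<dagger> * v = u\<^sup>\<dagger> * (M\<^sup>\<dagger> * v)"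
    using assms by (subst conj_transpose_mult) (auto intro!: mat_mult_assoc)
  then show ?thesis by (simp add: col_inner_def)
qed

text \<open>
  A matrix and its adjoint have the same operator norm. Expanding the squared norm of
  \<open>M u - \<sigma> v\<close> with \<open>u = M\<^sup>\<dagger> v\<close> shows this without the Cauchy-Schwarz inequality.
\<close>

lemma col_norm2_adjoint_le:
  assumes M: "M \<in> carrier_mat m n" and "0 < \<sigma>"
    and bound: "\<And>u. u \<in> carrier_mat n 1 \<Longrightarrow> col_norm2 (M * u) \<le> \<sigma> * col_norm2 u"
    and v: "v \<in> carrier_mat m 1"
  shows "col_norm2 (M\<^sup>\<dagger> * v) \<le> \<sigma> * col_norm2 v"
proof -
  define u where "u = M\<^sup>\<dagger> * v"
  have u: "u \<in> carrier_mat n 1" and Mu: "M * u \<in> carrier_mat m 1"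
    using M v by (auto simp: u_def)
  \<comment> \<open>The middle term of the expansion is the squared norm of \<open>u\<close>, since \<open>u\<close> is the adjoint
    image of \<open>v\<close>.\<close>
  have "0 \<le> col_norm2 (M * u - of_real \<sigma> \<cdot>\<^sub>m v)"
    using Mu v by (intro col_norm2_nonneg[of _ m]) auto
  also have "\<dots> = col_norm2 (M * u) - 2 * \<sigma> * col_norm2 u + \<sigma>\<^sup>2 * col_norm2 v"
    using col_inner_adjoint[OF M u v] by (simp only: col_norm2_diff_smult[OF Mu v] u_def[symmetric])
  also have "\<dots> \<le> \<sigma> * (\<sigma> * col_norm2 v - col_norm2 u)"
    using bound[OF u] by (simp add: algebra_simps power2_eq_square)
  finally show ?thesis
    using \<open>0 < \<sigma>\<close> by (simp add: zero_le_mult_iff u_def)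
qed

text \<open>
  By the bounds for \<open>M\<close> and its adjoint, the squared norm of \<open>M\<^sup>\<dagger> M x - \<sigma> x\<close> is at most
  \<open>\<sigma>\<^sup>2 - 2 \<sigma>\<^sup>2 + \<sigma>\<^sup>2 = 0\<close>.
\<close>

lemma maximal_col_is_eigenvector:
  assumes M: "M \<in> carrier_mat m n" and "0 < \<sigma>"
    and bound: "\<And>u. u \<in> carrier_mat n 1 \<Longrightarrow> col_norm2 (M * u) \<le> \<sigma> * col_norm2 u"
    and x: "x \<in> carrier_mat n 1" "col_norm2 x = 1" "col_norm2 (M * x) = \<sigma>"
  shows "M\<^sup>\<dagger> * (M * x) = of_real \<sigma> \<cdot>\<^sub>m x"
proof -
  have Mx: "M * x \<in> carrier_mat m 1" and MMx: "M\<^sup>\<dagger> * (M * x) \<in> carrier_mat n 1"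
    using M x by auto
  have inner: "col_inner (M\<^sup>\<dagger> * (M * x)) x = \<sigma>"
    using col_inner_adjoint[of "M\<^sup>\<dagger>" n m "M * x" x] M Mx x by simp
  have "col_norm2 (M\<^sup>\<dagger> * (M * x)) \<le> \<sigma> * \<sigma>"
    using col_norm2_adjoint_le[OF M \<open>0 < \<sigma>\<close> bound Mx] x by simp
  then have "col_norm2 (M\<^sup>\<dagger> * (M * x) - of_real \<sigma> \<cdot>\<^sub>m x) \<le> 0"
    using x inner by (simp add: col_norm2_diff_smult[OF MMx x(1)] power2_eq_square)
  moreover have "M\<^sup>\<dagger> * (M * x) - of_real \<sigma> \<cdot>\<^sub>m x \<in> carrier_mat n 1"
    using MMx x by auto
  ultimately have 0: "M\<^sup>\<dagger> * (M * x) - of_real \<sigma> \<cdot>\<^sub>m x = 0\<^sub>m n 1"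
    using col_norm2_eq_0_iff col_norm2_nonneg by (metis order_antisym)
  show ?thesis
  proof (rule eq_matI)
    fix i j assume "i < dim_row (of_real \<sigma> \<cdot>\<^sub>m x)" "j < dim_col (of_real \<sigma> \<cdot>\<^sub>m x)"
    then have ij: "i < n" "j < 1" using x by auto
    have "(M\<^sup>\<dagger> * (M * x) - of_real \<sigma> \<cdot>\<^sub>m x) $$ (i, j) = 0" using ij by (simp add: 0)
    moreover have "(M\<^sup>\<dagger> * (M * x) - of_real \<sigma> \<cdot>\<^sub>m x) $$ (i, j)
        = (M\<^sup>\<dagger> * (M * x)) $$ (i, j) - (of_real \<sigma> \<cdot>\<^sub>m x) $$ (i, j)"
      using ij x(1) by (intro index_minus_mat) auto
    ultimately show "(M\<^sup>\<dagger> * (M * x)) $$ (i, j) = (of_real \<sigma> \<cdot>\<^sub>m x) $$ (i, j)" by simp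
  qed (use MMx x in auto)
qed

section \<open>Existence of a norm-maximising unit column\<close>

text \<open>
  Columns are parametrised by real functions, since these carry the product topology. The
  pair \<open>(i, c)\<close> with \<open>c < 4\<close> indexes the real component \<open>c\<close> of the quaternion in row \<open>i\<close>, and
  one function space serves columns of every length.
\<close>

definition real_coords_col :: "nat \<Rightarrow> (nat \<times> nat \<Rightarrow> real) \<Rightarrow> quat mat" where
  "real_coords_col n g = mat n 1 (\<lambda>(i, _). Quat (g (i, 0)) (g (i, 1)) (g (i, 2)) (g (i, 3)))"

lemma real_coords_col_carrier [simp]: "real_coords_col n g \<in> carrier_mat n 1"
  by (simp add: real_coords_col_def)

lemma continuous_on_col_norm2_image:
  assumes M: "M \<in> carrier_mat m n"
  shows "continuous_on S (\<lambda>g. col_norm2 (M * real_coords_col n g))"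
proof -
  have idx: "(M * real_coords_col n g) $$ (i, 0)
      = (\<Sum>j<n. M $$ (i, j) * Quat (g (j, 0)) (g (j, 1)) (g (j, 2)) (g (j, 3)))" if "i < m" for i g
    unfolding real_coords_col_def by (subst index_mult_mat_of_fun[OF M that]) auto
  have coord: "continuous_on S (\<lambda>g :: nat \<times> nat \<Rightarrow> real. g p)" for p
    by (rule continuous_on_subset[OF continuous_on_product_coordinates]) simp
  have "M * real_coords_col n g \<in> carrier_mat m 1" for g
    using M by (intro mult_carrier_mat) auto
  then have "col_norm2 (M * real_coords_col n g) = (\<Sum>i<m. (qre ((M * real_coords_col n g) $$ (i, 0)))\<^sup>2
    + (qim1 ((M * real_coords_col n g) $$ (i, 0)))\<^sup>2 + (qim2 ((M * real_coords_col n g) $$ (i, 0)))\<^sup>2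
    + (qim3 ((M * real_coords_col n g) $$ (i, 0)))\<^sup>2)" for g
    by (rule col_norm2_eq_sum)
  moreover have "continuous_on S (\<lambda>g. (\<Sum>i<m. (qre ((M * real_coords_col n g) $$ (i, 0)))\<^sup>2
    + (qim1 ((M * real_coords_col n g) $$ (i, 0)))\<^sup>2 + (qim2 ((M * real_coords_col n g) $$ (i, 0)))\<^sup>2
    + (qim3 ((M * real_coords_col n g) $$ (i, 0)))\<^sup>2))"
  proof (rule continuous_on_sum)
    fix i assume "i \<in> {..<m}"
    then have "i < m" by simp
    show "continuous_on S (\<lambda>g. (qre ((M * real_coords_col n g) $$ (i, 0)))\<^sup>2
      + (qim1 ((M * real_coords_col n g) $$ (i, 0)))\<^sup>2 + (qim2 ((M * real_coords_col n g) $$ (i, 0)))\<^sup>2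
      + (qim3 ((M * real_coords_col n g) $$ (i, 0)))\<^sup>2)"
      unfolding idx[OF \<open>i < m\<close>] quat_sel_sum quat_sel_times quat.sel
      by (intro continuous_on_add continuous_on_diff continuous_on_mult continuous_on_power
          continuous_on_sum continuous_on_const coord)
  qed
  ultimately show ?thesis by simp
qed

text \<open>
  The unit columns are the image of a closed subset of the compact cube with sides
  \<open>[-1, 1]\<close>. Arbitrary columns are compared with the maximum after normalisation.
\<close>

lemma exists_maximal_unit_col:
  assumes M: "M \<in> carrier_mat m n" and "0 < n"
  shows "\<exists>x \<in> carrier_mat n 1. col_norm2 x = 1 \<and>
    (\<forall>u \<in> carrier_mat n 1. col_norm2 (M * u) \<le> col_norm2 (M * x) * col_norm2 u)"
proof -
  define box where "box = (PiE UNIV (\<lambda>_. {-1..1}) :: (nat \<times> nat \<Rightarrow> real) set)"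
  define K where "K = box \<inter> {g. col_norm2 (real_coords_col n g) = 1}"
  have "compactin (product_topology (\<lambda>_. euclideanreal) UNIV) box"
    unfolding box_def by (subst compactin_PiE) auto
  then have "compact box"
    by (simp add: euclidean_product_topology)
  moreover have "closed {g. col_norm2 (real_coords_col n g) = 1}"
  proof -
    have "continuous_on UNIV (\<lambda>g. col_norm2 (1\<^sub>m n * real_coords_col n g))"
      by (rule continuous_on_col_norm2_image[of _ n]) simp
    then show ?thesis
      by (intro closed_Collect_eq continuous_intros) (simp add: real_coords_col_def)
  qed
  ultimately have "compact K" unfolding K_def by (rule compact_Int_closed)
  have surj: "\<exists>g\<in>K. real_coords_col n g = u" if u: "u \<in> carrier_mat n 1" "col_norm2 u = 1" for u
  proof -
    \<comment> \<open>Coordinates outside the relevant range are set to 0 to stay in the cube.\<close>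
    define g where "g = (\<lambda>(i, c::nat). if i < n then
      (if c = 0 then qre (u $$ (i, 0)) else if c = 1 then qim1 (u $$ (i, 0))
       else if c = 2 then qim2 (u $$ (i, 0)) else qim3 (u $$ (i, 0))) else 0)"
    have eq: "real_coords_col n g = u"
      using u(1) by (intro eq_matI) (auto simp: real_coords_col_def g_def)
    have le: "(qre (u $$ (i, 0)))\<^sup>2 + (qim1 (u $$ (i, 0)))\<^sup>2 + (qim2 (u $$ (i, 0)))\<^sup>2 + (qim3 (u $$ (i, 0)))\<^sup>2 \<le> 1"
      if "i < n" for i
      unfolding u(2)[symmetric] col_norm2_eq_sum[OF u(1)]
      by (rule member_le_sum[of i]) (use that in auto)
    have "\<bar>g (i, c)\<bar> \<le> 1" for i c
    proof -
      have "(g (i, c))\<^sup>2 \<le> 1"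
      proof (cases "i < n")
        case True
        have "0 \<le> (qre (u $$ (i, 0)))\<^sup>2" "0 \<le> (qim1 (u $$ (i, 0)))\<^sup>2"
          "0 \<le> (qim2 (u $$ (i, 0)))\<^sup>2" "0 \<le> (qim3 (u $$ (i, 0)))\<^sup>2" by simp_all
        with le[OF True] have "(qre (u $$ (i, 0)))\<^sup>2 \<le> 1" "(qim1 (u $$ (i, 0)))\<^sup>2 \<le> 1"
          "(qim2 (u $$ (i, 0)))\<^sup>2 \<le> 1" "(qim3 (u $$ (i, 0)))\<^sup>2 \<le> 1" by linarith+
        then show ?thesis by (simp add: g_def)
      qed (simp add: g_def)
      then show ?thesis by (simp add: abs_square_le_1)
    qed
    then have "g \<in> box" by (force simp: box_def abs_le_iff)
    then show ?thesis using eq u(2) by (auto simp: K_def)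
  qed
  have "K \<noteq> {}"
  proof -
    let ?e = "mat n 1 (\<lambda>(i, _). if i = 0 then 1 else 0 :: quat)"
    have "col_norm2 ?e = (\<Sum>i<n. if i = 0 then 1 else 0)"
      by (subst col_norm2_eq_sum[of _ n], simp, rule sum.cong) auto
    also have "\<dots> = 1" using \<open>0 < n\<close> by simp
    finally show ?thesis using surj[of ?e] by auto
  qed
  have "\<exists>g\<in>K. \<forall>h\<in>K. col_norm2 (M * real_coords_col n h) \<le> col_norm2 (M * real_coords_col n g)"
    by (rule continuous_attains_sup[OF \<open>compact K\<close> \<open>K \<noteq> {}\<close> continuous_on_col_norm2_image[OF M]])
  then obtain g where g: "g \<in> K"
    "\<And>h. h \<in> K \<Longrightarrow> col_norm2 (M * real_coords_col n h) \<le> col_norm2 (M * real_coords_col n g)"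
    by (elim bexE) (rule that, assumption, elim ballE, auto)
  let ?x = "real_coords_col n g"
  have "col_norm2 (M * u) \<le> col_norm2 (M * ?x) * col_norm2 u" if u: "u \<in> carrier_mat n 1" for u
  proof (cases "u = 0\<^sub>m n 1")
    case True
    have "M * u \<in> carrier_mat m 1" "M * u = 0\<^sub>m m 1" using True M by auto
    then have "col_norm2 (M * u) = 0" using col_norm2_eq_0_iff[of "M * u" m] by blast
    moreover have "col_norm2 u = 0" using True col_norm2_eq_0_iff[OF u] by blast
    ultimately show ?thesis by simp
  next
    case False
    then have pos: "0 < col_norm2 u"
      using col_norm2_eq_0_iff[OF u] col_norm2_nonneg[OF u] by simp
    define c where "c = 1 / sqrt (col_norm2 u)"
    have c2: "c\<^sup>2 = 1 / col_norm2 u" using pos by (simp add: c_def power_divide)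
    have "of_real c \<cdot>\<^sub>m u \<in> carrier_mat n 1" "col_norm2 (of_real c \<cdot>\<^sub>m u) = 1"
      using u pos by (auto simp: col_norm2_smult[OF u] c2)
    from surj[OF this] obtain h where "h \<in> K" "real_coords_col n h = of_real c \<cdot>\<^sub>m u"
      by blast
    with g(2)[of h] have "col_norm2 (M * (of_real c \<cdot>\<^sub>m u)) \<le> col_norm2 (M * ?x)"
      by simp
    moreover have "M * (of_real c \<cdot>\<^sub>m u) = of_real c \<cdot>\<^sub>m (M * u)"
      using M u by (intro mat_mult_smult_of_real) auto
    moreover have "M * u \<in> carrier_mat m 1" using M u by auto
    ultimately have "col_norm2 (M * u) / col_norm2 u \<le> col_norm2 (M * ?x)"
      by (simp add: col_norm2_smult c2)
    then show ?thesis using pos by (simp add: pos_divide_le_eq)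
  qed
  then show ?thesis using g(1) by (intro bexI[of _ ?x]) (auto simp: K_def)
qed

section \<open>Kernels and orthonormal completion\<close>

lemma smult_of_real_smult: "of_real a \<cdot>\<^sub>m (of_real b \<cdot>\<^sub>m X) = (of_real (a * b) :: quat) \<cdot>\<^sub>m X"
  by (simp add: smult_smult_mat)

lemma normalize_col:
  assumes "u \<in> carrier_mat n 1" "u \<noteq> 0\<^sub>m n 1"
  shows "\<exists>c. col_norm2 (of_real c \<cdot>\<^sub>m u) = 1"
proof -
  have "0 < col_norm2 u"
    using assms col_norm2_eq_0_iff[OF assms(1)] col_norm2_nonneg[OF assms(1)] by linarith
  then have "col_norm2 (of_real (1 / sqrt (col_norm2 u)) \<cdot>\<^sub>m u) = 1"
    by (simp only: col_norm2_smult[OF assms(1)]) (simp add: power_divide)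
  then show ?thesis by (rule exI)
qed

lemma unit_col_in_kernel:
  assumes M: "M \<in> carrier_mat m n" and x: "x \<in> carrier_mat n 1" "x \<noteq> 0\<^sub>m n 1" "M * x = 0\<^sub>m m 1"
  shows "\<exists>v \<in> carrier_mat n 1. col_norm2 v = 1 \<and> M * v = 0\<^sub>m m 1"
proof -
  obtain c where c: "col_norm2 (of_real c \<cdot>\<^sub>m x) = 1"
    using normalize_col[OF x(1,2)] by (rule exE)
  have "M * (of_real c \<cdot>\<^sub>m x) = of_real c \<cdot>\<^sub>m (M * x)"
    using M x(1) by (intro mat_mult_smult_of_real) auto
  also have "\<dots> = 0\<^sub>m m 1" unfolding x(3) by (rule smult_zero_mat)
  finally show ?thesis
    using c x(1) by (intro bexI[of _ "of_real c \<cdot>\<^sub>m x"]) auto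
qed

text \<open>
  If \<open>M\<close> were injective, it would have a right inverse \<open>R\<close>, and \<open>z = (M R)\<^sup>\<dagger> z = R\<^sup>\<dagger> (M\<^sup>\<dagger> z)\<close>
  would vanish.
\<close>

lemma square_kernel_of_adjoint_kernel:
  assumes M: "M \<in> carrier_mat n n" and z: "z \<in> carrier_mat n 1" "z \<noteq> 0\<^sub>m n 1" "M\<^sup>\<dagger> * z = 0\<^sub>m n 1"
  shows "\<exists>w \<in> carrier_mat n 1. col_norm2 w = 1 \<and> M * w = 0\<^sub>m n 1"
proof (rule ccontr)
  assume neg: "\<not> ?thesis"
  have "\<exists>R \<in> carrier_mat n n. M * R = 1\<^sub>m n"
  proof (rule square_injective_right_inverse[OF M])
    fix x assume x: "x \<in> carrier_mat n 1" "M * x = 0\<^sub>m n 1"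
    show "x = 0\<^sub>m n 1"
    proof (rule ccontr)
      assume "x \<noteq> 0\<^sub>m n 1"
      from unit_col_in_kernel[OF M x(1) this x(2)] neg show False by (rule notE[rotated])
    qed
  qed
  then obtain R where R: "R \<in> carrier_mat n n" "M * R = 1\<^sub>m n" by (rule bexE)
  have "(M * R)\<^sup>\<dagger> * z = R\<^sup>\<dagger> * (M\<^sup>\<dagger> * z)"
    using M R(1) z(1) by (subst conj_transpose_mult) (auto intro!: mat_mult_assoc)
  then have "z = 0\<^sub>m n 1" using R z by simp
  with z(2) show False by (rule notE)
qed

text \<open>
  Appending a column is written as a block matrix with empty lower blocks, so that
  products and adjoints follow from the block rules.
\<close>

definition snoc_col :: "quat mat \<Rightarrow> quat mat \<Rightarrow> quat mat" where
  "snoc_col W v = four_block_mat W v (0\<^sub>m 0 (dim_col W)) (0\<^sub>m 0 1)"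

lemma snoc_col_carrier [simp]:
  "W \<in> carrier_mat n j \<Longrightarrow> v \<in> carrier_mat n 1 \<Longrightarrow> snoc_col W v \<in> carrier_mat n (Suc j)"
  unfolding snoc_col_def carrier_mat_def by (simp add: One_nat_def)

lemma conj_transpose_snoc_col:
  assumes "W \<in> carrier_mat n j" "v \<in> carrier_mat n 1"
  shows "(snoc_col W v)\<^sup>\<dagger> = four_block_mat (W\<^sup>\<dagger>) (0\<^sub>m j 0) (v\<^sup>\<dagger>) (0\<^sub>m 1 0)"
  using assms unfolding snoc_col_def
  by (subst conj_transpose_four_block[of _ n j _ 1 _ 0]) auto

lemma gram_snoc_col:
  assumes "W \<in> carrier_mat n j" "v \<in> carrier_mat n 1"
  shows "(snoc_col W v)\<^sup>\<dagger> * snoc_col W v = four_block_mat (W\<^sup>\<dagger> * W) (W\<^sup>\<dagger> * v) (v\<^sup>\<dagger> * W) (v\<^sup>\<dagger> * v)"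
  unfolding conj_transpose_snoc_col[OF assms]
  using assms unfolding snoc_col_def
  by (subst mult_four_block_mat[of _ j n _ 0 _ 1 _ _ j _ 1]) auto

lemma snoc_col_isometry:
  assumes "W \<in> carrier_mat n j" "v \<in> carrier_mat n 1"
    and "W\<^sup>\<dagger> * W = 1\<^sub>m j" "W\<^sup>\<dagger> * v = 0\<^sub>m j 1" "v\<^sup>\<dagger> * v = 1\<^sub>m 1"
  shows "(snoc_col W v)\<^sup>\<dagger> * snoc_col W v = 1\<^sub>m (Suc j)"
proof -
  have "v\<^sup>\<dagger> * W = (W\<^sup>\<dagger> * v)\<^sup>\<dagger>"
    using assms(1,2) by (subst conj_transpose_mult) auto
  then have "v\<^sup>\<dagger> * W = 0\<^sub>m 1 j" by (simp add: assms)
  then show ?thesis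
    unfolding gram_snoc_col[OF assms(1,2)] assms(3-5) by (simp add: One_nat_def)
qed

text \<open>
  The outer-product expansion of a product with a bordered middle factor. This is how a
  new singular value is added to a decomposition.
\<close>

lemma snoc_col_block_product:
  assumes "W \<in> carrier_mat m i" "v \<in> carrier_mat m 1" "U \<in> carrier_mat n j" "u \<in> carrier_mat n 1"
    and "D \<in> carrier_mat i j"
  shows "snoc_col W v * four_block_mat D (0\<^sub>m i 1) (0\<^sub>m 1 j) (of_real c \<cdot>\<^sub>m 1\<^sub>m 1) * (snoc_col U u)\<^sup>\<dagger>
    = W * D * U\<^sup>\<dagger> + of_real c \<cdot>\<^sub>m (v * u\<^sup>\<dagger>)"
proof -
  have vc: "v * (of_real c \<cdot>\<^sub>m 1\<^sub>m 1) = of_real c \<cdot>\<^sub>m v"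
    using assms(2) by (subst mat_mult_smult_of_real) auto
  have 1: "snoc_col W v * four_block_mat D (0\<^sub>m i 1) (0\<^sub>m 1 j) (of_real c \<cdot>\<^sub>m 1\<^sub>m 1)
      = four_block_mat (W * D) (of_real c \<cdot>\<^sub>m v) (0\<^sub>m 0 j) (0\<^sub>m 0 1)"
    using assms vc unfolding snoc_col_def
    by (subst mult_four_block_mat[of _ m i _ 1 _ 0 _ _ j _ 1]) auto
  have 2: "four_block_mat (W * D) (of_real c \<cdot>\<^sub>m v) (0\<^sub>m 0 j) (0\<^sub>m 0 1) *
      four_block_mat (U\<^sup>\<dagger>) (0\<^sub>m j 0) (u\<^sup>\<dagger>) (0\<^sub>m 1 0)
     = four_block_mat (W * D * U\<^sup>\<dagger> + of_real c \<cdot>\<^sub>m v * u\<^sup>\<dagger>) (0\<^sub>m m 0) (0\<^sub>m 0 n) (0\<^sub>m 0 0)"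
    using assms by (subst mult_four_block_mat[of _ m j _ 1 _ 0 _ _ n _ 0]) auto
  have 3: "of_real c \<cdot>\<^sub>m v * u\<^sup>\<dagger> = of_real c \<cdot>\<^sub>m (v * u\<^sup>\<dagger>)"
    using assms by (intro mat_smult_mult) auto
  have 4: "four_block_mat X (0\<^sub>m m 0) (0\<^sub>m 0 n) (0\<^sub>m 0 0) = X" if "X \<in> carrier_mat m n" for X :: "quat mat"
    using that by (intro eq_matI) auto
  have 5: "W * D * U\<^sup>\<dagger> + of_real c \<cdot>\<^sub>m (v * u\<^sup>\<dagger>) \<in> carrier_mat m n"
    using assms by (intro add_carrier_mat smult_carrier_mat mult_carrier_mat) auto
  show ?thesis
    unfolding 1 conj_transpose_snoc_col[OF assms(3,4)] 2 3 by (rule 4[OF 5])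
qed

lemma snoc_col_mult_adjoint:
  assumes "W \<in> carrier_mat n j" "v \<in> carrier_mat n 1"
  shows "snoc_col W v * (snoc_col W v)\<^sup>\<dagger> = W * W\<^sup>\<dagger> + v * v\<^sup>\<dagger>"
proof -
  have "four_block_mat (1\<^sub>m j) (0\<^sub>m j 1) (0\<^sub>m 1 j) (of_real 1 \<cdot>\<^sub>m 1\<^sub>m 1) = (1\<^sub>m (Suc j) :: quat mat)"
    by (simp add: One_nat_def)
  then show ?thesis
    using snoc_col_block_product[of W n j v W n j v "1\<^sub>m j" 1, OF assms assms] assms
      snoc_col_carrier[OF assms] by simp
qed

lemma adjoint_snoc_col_kernel:
  assumes "W \<in> carrier_mat n j" "x \<in> carrier_mat n 1" "v \<in> carrier_mat n 1"
    and "(snoc_col W x)\<^sup>\<dagger> * v = 0\<^sub>m (Suc j) 1"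
  shows "W\<^sup>\<dagger> * v = 0\<^sub>m j 1" "x\<^sup>\<dagger> * v = 0\<^sub>m 1 1"
proof -
  have idx: "((snoc_col W x)\<^sup>\<dagger> * v) $$ (i, 0)
      = (\<Sum>l<n. quat_cnj (if i < j then W $$ (l, i) else x $$ (l, 0)) * v $$ (l, 0))"
    if "i < Suc j" for i
    using assms(1-3) that unfolding snoc_col_def
    by (auto simp: scalar_prod_def lessThan_atLeast0 less_Suc_eq intro!: sum.cong)
  have "(W\<^sup>\<dagger> * v) $$ (i, 0) = ((snoc_col W x)\<^sup>\<dagger> * v) $$ (i, 0)" if "i < j" for i
    using assms(1-3) that by (subst idx) (auto simp: scalar_prod_def lessThan_atLeast0)
  then show "W\<^sup>\<dagger> * v = 0\<^sub>m j 1"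
    using assms by (intro eq_matI) auto
  have "(x\<^sup>\<dagger> * v) $$ (0, 0) = ((snoc_col W x)\<^sup>\<dagger> * v) $$ (j, 0)"
    using assms(1-3) by (subst idx) (auto simp: scalar_prod_def lessThan_atLeast0)
  then show "x\<^sup>\<dagger> * v = 0\<^sub>m 1 1"
    using assms by (intro eq_matI) auto
qed

text \<open>
  The columns are found one at a time: as long as there are, with \<open>x\<close>, fewer than \<open>n\<close>, the
  orthogonality conditions form an underdetermined system, and a solution can be
  normalised.
\<close>

lemma orthonormal_cols_orthogonal_to:
  assumes x: "x \<in> carrier_mat n 1" "x\<^sup>\<dagger> * x = 1\<^sub>m 1" and "j < n"
  shows "\<exists>W \<in> carrier_mat n j. W\<^sup>\<dagger> * W = 1\<^sub>m j \<and> W\<^sup>\<dagger> * x = 0\<^sub>m j 1"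
  using \<open>j < n\<close>
proof (induction j)
  case 0
  have "(0\<^sub>m n 0)\<^sup>\<dagger> * 0\<^sub>m n 0 = (1\<^sub>m 0 :: quat mat)" "(0\<^sub>m n 0)\<^sup>\<dagger> * x = 0\<^sub>m 0 1"
    using x(1) by (auto intro!: eq_matI)
  then show ?case by (intro bexI[of _ "0\<^sub>m n 0"]) auto
next
  case (Suc j)
  then have "\<exists>W \<in> carrier_mat n j. W\<^sup>\<dagger> * W = 1\<^sub>m j \<and> W\<^sup>\<dagger> * x = 0\<^sub>m j 1" by simp
  then obtain W where W: "W \<in> carrier_mat n j" "W\<^sup>\<dagger> * W = 1\<^sub>m j" "W\<^sup>\<dagger> * x = 0\<^sub>m j 1"
    by (elim bexE conjE)
  let ?M = "(snoc_col W x)\<^sup>\<dagger>"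
  have M: "?M \<in> carrier_mat (Suc j) n" using W(1) x(1) by simp
  obtain u where u: "u \<in> carrier_mat n 1" "u \<noteq> 0\<^sub>m n 1" "?M * u = 0\<^sub>m (Suc j) 1"
    using wide_matrix_kernel[OF M \<open>Suc j < n\<close>] by (elim bexE conjE)
  obtain v where v: "v \<in> carrier_mat n 1" "col_norm2 v = 1" "?M * v = 0\<^sub>m (Suc j) 1"
    using unit_col_in_kernel[OF M u] by (elim bexE conjE)
  note k = adjoint_snoc_col_kernel[OF W(1) x(1) v(1,3)]
  have vx: "v\<^sup>\<dagger> * x = 0\<^sub>m 1 1"
  proof -
    have "v\<^sup>\<dagger> * x = (x\<^sup>\<dagger> * v)\<^sup>\<dagger>" using x(1) v(1) by (subst conj_transpose_mult) auto
    then show ?thesis by (simp add: k)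
  qed
  have "(snoc_col W v)\<^sup>\<dagger> * snoc_col W v = 1\<^sub>m (Suc j)"
    using W v unit_col_iff[OF v(1)] k by (intro snoc_col_isometry) auto
  moreover have "(snoc_col W v)\<^sup>\<dagger> * x = 0\<^sub>m (Suc j) 1"
  proof -
    have "four_block_mat (W\<^sup>\<dagger>) (0\<^sub>m j 0) (v\<^sup>\<dagger>) (0\<^sub>m 1 0) * four_block_mat x (0\<^sub>m n 0) (0\<^sub>m 0 1) (0\<^sub>m 0 0)
        = four_block_mat (W\<^sup>\<dagger> * x) (0\<^sub>m j 0) (v\<^sup>\<dagger> * x) (0\<^sub>m 1 0)"
      using W(1) v(1) x(1) by (subst mult_four_block_mat[of _ j n _ 0 _ 1 _ _ 1 _ 0]) auto
    also have "\<dots> = 0\<^sub>m (Suc j) 1"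
      unfolding W(3) vx by (rule eq_matI) auto
    also have "four_block_mat x (0\<^sub>m n 0) (0\<^sub>m 0 1) (0\<^sub>m 0 0) = x"
      using x(1) by (intro eq_matI) auto
    finally show ?thesis unfolding conj_transpose_snoc_col[OF W(1) v(1)] .
  qed
  ultimately show ?case
    using W(1) v(1) by (intro bexI[of _ "snoc_col W v"]) auto
qed

text \<open>
  \<open>W\<close> together with \<open>x\<close> is a square isometry, hence unitary on both sides; the last equation
  is the resolution of the identity into the projections along \<open>W\<close> and \<open>x\<close>.
\<close>

lemma unitary_completion:
  assumes x: "x \<in> carrier_mat (Suc n) 1" "col_norm2 x = 1"
  shows "\<exists>W \<in> carrier_mat (Suc n) n. W\<^sup>\<dagger> * W = 1\<^sub>m n \<and> W\<^sup>\<dagger> * x = 0\<^sub>m n 1 \<and> W * W\<^sup>\<dagger> + x * x\<^sup>\<dagger> = 1\<^sub>m (Suc n)"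
proof -
  have xx: "x\<^sup>\<dagger> * x = 1\<^sub>m 1" using x unit_col_iff by blast
  obtain W where W: "W \<in> carrier_mat (Suc n) n" "W\<^sup>\<dagger> * W = 1\<^sub>m n" "W\<^sup>\<dagger> * x = 0\<^sub>m n 1"
    using orthonormal_cols_orthogonal_to[OF x(1) xx lessI] by (elim bexE conjE)
  have "snoc_col W x \<in> Sp (Suc n)"
    using snoc_col_isometry[OF W(1) x(1) W(2,3) xx] W(1) x(1) by (intro SpI) auto
  then have "snoc_col W x * (snoc_col W x)\<^sup>\<dagger> = 1\<^sub>m (Suc n)" by (rule SpD)
  then show ?thesis using W unfolding snoc_col_mult_adjoint[OF W(1) x(1)]
    by (intro bexI[of _ W] conjI)
qed

section \<open>Unitary block matrices\<close>

lemma four_block_mat_eq_iff: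
  assumes "A \<in> carrier_mat n1 m1" "B \<in> carrier_mat n1 m2" "C \<in> carrier_mat n2 m1" "D \<in> carrier_mat n2 m2"
    and "A' \<in> carrier_mat n1 m1" "B' \<in> carrier_mat n1 m2" "C' \<in> carrier_mat n2 m1" "D' \<in> carrier_mat n2 m2"
  shows "four_block_mat A B C D = four_block_mat A' B' C' D' \<longleftrightarrow> A = A' \<and> B = B' \<and> C = C' \<and> D = D'"
proof
  assume eq: "four_block_mat A B C D = four_block_mat A' B' C' D'"
  have idx: "four_block_mat A B C D $$ (i, j) = four_block_mat A' B' C' D' $$ (i, j)" for i j
    by (simp only: eq)
  have "A = A'"
  proof (rule eq_matI)
    fix i j assume "i < dim_row A'" "j < dim_col A'"
    then show "A $$ (i, j) = A' $$ (i, j)" using idx[of i j] assms by simp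
  qed (use assms in auto)
  moreover have "B = B'"
  proof (rule eq_matI)
    fix i j assume "i < dim_row B'" "j < dim_col B'"
    then show "B $$ (i, j) = B' $$ (i, j)" using idx[of i "m1 + j"] assms by simp
  qed (use assms in auto)
  moreover have "C = C'"
  proof (rule eq_matI)
    fix i j assume "i < dim_row C'" "j < dim_col C'"
    then show "C $$ (i, j) = C' $$ (i, j)" using idx[of "n1 + i" j] assms by simp
  qed (use assms in auto)
  moreover have "D = D'"
  proof (rule eq_matI)
    fix i j assume "i < dim_row D'" "j < dim_col D'"
    then show "D $$ (i, j) = D' $$ (i, j)" using idx[of "n1 + i" "m1 + j"] assms by simp
  qed (use assms in auto)
  ultimately show "A = A' \<and> B = B' \<and> C = C' \<and> D = D'" by (intro conjI)
qed simp

lemma four_block_mult_adjoint: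
  assumes "\<alpha> \<in> carrier_mat j j" "T \<in> carrier_mat j k" "\<beta> \<in> carrier_mat k j" "P \<in> carrier_mat k k"
  shows "four_block_mat \<alpha> T \<beta> P * (four_block_mat \<alpha> T \<beta> P)\<^sup>\<dagger> =
    four_block_mat (\<alpha> * \<alpha>\<^sup>\<dagger> + T * T\<^sup>\<dagger>) (\<alpha> * \<beta>\<^sup>\<dagger> + T * P\<^sup>\<dagger>) (\<beta> * \<alpha>\<^sup>\<dagger> + P * T\<^sup>\<dagger>) (\<beta> * \<beta>\<^sup>\<dagger> + P * P\<^sup>\<dagger>)"
  unfolding conj_transpose_four_block[OF assms]
  using assms by (intro mult_four_block_mat[of _ j j _ k _ k]) auto

lemma four_block_adjoint_mult:
  assumes "\<alpha> \<in> carrier_mat j j" "T \<in> carrier_mat j k" "\<beta> \<in> carrier_mat k j" "P \<in> carrier_mat k k"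
  shows "(four_block_mat \<alpha> T \<beta> P)\<^sup>\<dagger> * four_block_mat \<alpha> T \<beta> P =
    four_block_mat (\<alpha>\<^sup>\<dagger> * \<alpha> + \<beta>\<^sup>\<dagger> * \<beta>) (\<alpha>\<^sup>\<dagger> * T + \<beta>\<^sup>\<dagger> * P) (T\<^sup>\<dagger> * \<alpha> + P\<^sup>\<dagger> * \<beta>) (T\<^sup>\<dagger> * T + P\<^sup>\<dagger> * P)"
  unfolding conj_transpose_four_block[OF assms]
  using assms by (intro mult_four_block_mat[of _ j j _ k _ k]) auto

definition unitary_blocks :: "nat \<Rightarrow> nat \<Rightarrow> quat mat \<Rightarrow> quat mat \<Rightarrow> quat mat \<Rightarrow> quat mat \<Rightarrow> bool" where
  "unitary_blocks j k \<alpha> T \<beta> P \<longleftrightarrow>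
    \<alpha> \<in> carrier_mat j j \<and> T \<in> carrier_mat j k \<and> \<beta> \<in> carrier_mat k j \<and> P \<in> carrier_mat k k \<and>
    four_block_mat \<alpha> T \<beta> P \<in> Sp (j + k)"

lemma unitary_blocks_carrier:
  assumes "unitary_blocks j k \<alpha> T \<beta> P"
  shows "\<alpha> \<in> carrier_mat j j" "T \<in> carrier_mat j k" "\<beta> \<in> carrier_mat k j" "P \<in> carrier_mat k k"
  using assms by (auto simp: unitary_blocks_def)

lemma unitary_blocks_iff:
  "unitary_blocks j k \<alpha> T \<beta> P \<longleftrightarrow>
    \<alpha> \<in> carrier_mat j j \<and> T \<in> carrier_mat j k \<and> \<beta> \<in> carrier_mat k j \<and> P \<in> carrier_mat k k \<and>
    \<alpha> * \<alpha>\<^sup>\<dagger> + T * T\<^sup>\<dagger> = 1\<^sub>m j \<and> \<alpha> * \<beta>\<^sup>\<dagger> + T * P\<^sup>\<dagger> = 0\<^sub>m j k \<and>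
    \<beta> * \<alpha>\<^sup>\<dagger> + P * T\<^sup>\<dagger> = 0\<^sub>m k j \<and> \<beta> * \<beta>\<^sup>\<dagger> + P * P\<^sup>\<dagger> = 1\<^sub>m k"
proof (cases "\<alpha> \<in> carrier_mat j j \<and> T \<in> carrier_mat j k \<and> \<beta> \<in> carrier_mat k j \<and> P \<in> carrier_mat k k")
  case True
  then have c: "\<alpha> \<in> carrier_mat j j" "T \<in> carrier_mat j k" "\<beta> \<in> carrier_mat k j" "P \<in> carrier_mat k k"
    by simp_all
  have "four_block_mat \<alpha> T \<beta> P \<in> Sp (j + k) \<longleftrightarrow>
    four_block_mat (\<alpha> * \<alpha>\<^sup>\<dagger> + T * T\<^sup>\<dagger>) (\<alpha> * \<beta>\<^sup>\<dagger> + T * P\<^sup>\<dagger>) (\<beta> * \<alpha>\<^sup>\<dagger> + P * T\<^sup>\<dagger>) (\<beta> * \<beta>\<^sup>\<dagger> + P * P\<^sup>\<dagger>)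
    = four_block_mat (1\<^sub>m j) (0\<^sub>m j k) (0\<^sub>m k j) (1\<^sub>m k)"
    using c unfolding Sp_def four_block_one_mat four_block_mult_adjoint[OF c, symmetric] by simp
  also have "\<dots> \<longleftrightarrow> \<alpha> * \<alpha>\<^sup>\<dagger> + T * T\<^sup>\<dagger> = 1\<^sub>m j \<and> \<alpha> * \<beta>\<^sup>\<dagger> + T * P\<^sup>\<dagger> = 0\<^sub>m j k \<and>
    \<beta> * \<alpha>\<^sup>\<dagger> + P * T\<^sup>\<dagger> = 0\<^sub>m k j \<and> \<beta> * \<beta>\<^sup>\<dagger> + P * P\<^sup>\<dagger> = 1\<^sub>m k"
    using c by (intro four_block_mat_eq_iff) auto
  finally show ?thesis using c by (simp add: unitary_blocks_def)
qed (auto simp: unitary_blocks_def)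

text \<open>
  These are the relations between the columns of the block matrix. They are not symmetric
  reformulations of the row relations: they use that a right inverse is a left inverse.
\<close>

lemma unitary_blocks_adjoint_products:
  assumes "unitary_blocks j k \<alpha> T \<beta> P"
  shows "\<alpha>\<^sup>\<dagger> * \<alpha> + \<beta>\<^sup>\<dagger> * \<beta> = 1\<^sub>m j" "\<alpha>\<^sup>\<dagger> * T + \<beta>\<^sup>\<dagger> * P = 0\<^sub>m j k"
    "T\<^sup>\<dagger> * \<alpha> + P\<^sup>\<dagger> * \<beta> = 0\<^sub>m k j" "T\<^sup>\<dagger> * T + P\<^sup>\<dagger> * P = 1\<^sub>m k"
proof -
  note c = unitary_blocks_carrier[OF assms]
  have "(four_block_mat \<alpha> T \<beta> P)\<^sup>\<dagger> * four_block_mat \<alpha> T \<beta> P = 1\<^sub>m (j + k)"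
    using assms unfolding unitary_blocks_def by (intro SpD) simp
  then have "four_block_mat (\<alpha>\<^sup>\<dagger> * \<alpha> + \<beta>\<^sup>\<dagger> * \<beta>) (\<alpha>\<^sup>\<dagger> * T + \<beta>\<^sup>\<dagger> * P) (T\<^sup>\<dagger> * \<alpha> + P\<^sup>\<dagger> * \<beta>) (T\<^sup>\<dagger> * T + P\<^sup>\<dagger> * P)
    = four_block_mat (1\<^sub>m j) (0\<^sub>m j k) (0\<^sub>m k j) (1\<^sub>m k)"
    by (simp only: four_block_adjoint_mult[OF c] four_block_one_mat)
  moreover have "four_block_mat (\<alpha>\<^sup>\<dagger> * \<alpha> + \<beta>\<^sup>\<dagger> * \<beta>) (\<alpha>\<^sup>\<dagger> * T + \<beta>\<^sup>\<dagger> * P) (T\<^sup>\<dagger> * \<alpha> + P\<^sup>\<dagger> * \<beta>) (T\<^sup>\<dagger> * T + P\<^sup>\<dagger> * P)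
    = four_block_mat (1\<^sub>m j) (0\<^sub>m j k) (0\<^sub>m k j) (1\<^sub>m k) \<longleftrightarrow> \<alpha>\<^sup>\<dagger> * \<alpha> + \<beta>\<^sup>\<dagger> * \<beta> = 1\<^sub>m j \<and> \<alpha>\<^sup>\<dagger> * T + \<beta>\<^sup>\<dagger> * P = 0\<^sub>m j k \<and>
    T\<^sup>\<dagger> * \<alpha> + P\<^sup>\<dagger> * \<beta> = 0\<^sub>m k j \<and> T\<^sup>\<dagger> * T + P\<^sup>\<dagger> * P = 1\<^sub>m k"
    using c by (intro four_block_mat_eq_iff) auto
  ultimately have "\<alpha>\<^sup>\<dagger> * \<alpha> + \<beta>\<^sup>\<dagger> * \<beta> = 1\<^sub>m j \<and> \<alpha>\<^sup>\<dagger> * T + \<beta>\<^sup>\<dagger> * P = 0\<^sub>m j k \<and>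
    T\<^sup>\<dagger> * \<alpha> + P\<^sup>\<dagger> * \<beta> = 0\<^sub>m k j \<and> T\<^sup>\<dagger> * T + P\<^sup>\<dagger> * P = 1\<^sub>m k"
    by (rule iffD1[rotated])
  then show "\<alpha>\<^sup>\<dagger> * \<alpha> + \<beta>\<^sup>\<dagger> * \<beta> = 1\<^sub>m j" "\<alpha>\<^sup>\<dagger> * T + \<beta>\<^sup>\<dagger> * P = 0\<^sub>m j k"
    "T\<^sup>\<dagger> * \<alpha> + P\<^sup>\<dagger> * \<beta> = 0\<^sub>m k j" "T\<^sup>\<dagger> * T + P\<^sup>\<dagger> * P = 1\<^sub>m k" by simp_all
qed

text \<open>
  The pair \<open>(M, L)\<close>, stacked, is an isometry. It is applied to the block columns of a
  unitary matrix and to the adjoints of its block rows.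
\<close>

lemma pythagoras_isometric_pair:
  assumes "M \<in> carrier_mat m n" "L \<in> carrier_mat m' n" "u \<in> carrier_mat n 1"
    and "M\<^sup>\<dagger> * M + L\<^sup>\<dagger> * L = 1\<^sub>m n"
  shows "M\<^sup>\<dagger> * (M * u) + L\<^sup>\<dagger> * (L * u) = u" "col_norm2 (M * u) + col_norm2 (L * u) = col_norm2 u"
proof -
  have "(M\<^sup>\<dagger> * M + L\<^sup>\<dagger> * L) * u = M\<^sup>\<dagger> * (M * u) + L\<^sup>\<dagger> * (L * u)"
    using assms(1-3) by (simp add: mat_add_mult_distrib mat_mult_assoc)
  then show 1: "M\<^sup>\<dagger> * (M * u) + L\<^sup>\<dagger> * (L * u) = u" using assms(3,4) by simp
  have "u\<^sup>\<dagger> * (M\<^sup>\<dagger> * (M * u) + L\<^sup>\<dagger> * (L * u)) = (M * u)\<^sup>\<dagger> * (M * u) + (L * u)\<^sup>\<dagger> * (L * u)"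
    using assms(1-3) by (simp add: mat_algebra)
  then have "(M * u)\<^sup>\<dagger> * (M * u) + (L * u)\<^sup>\<dagger> * (L * u) = u\<^sup>\<dagger> * u" by (simp only: 1)
  moreover have "((M * u)\<^sup>\<dagger> * (M * u) + (L * u)\<^sup>\<dagger> * (L * u)) $$ (0, 0)
    = ((M * u)\<^sup>\<dagger> * (M * u)) $$ (0, 0) + ((L * u)\<^sup>\<dagger> * (L * u)) $$ (0, 0)"
    using assms(1-3) by (intro index_add_mat) auto
  ultimately show "col_norm2 (M * u) + col_norm2 (L * u) = col_norm2 u"
    unfolding col_inner_def by simp
qed

lemma add_smult_cancel:
  assumes "X \<in> carrier_mat n m" "V \<in> carrier_mat n m"
    and "X + of_real a \<cdot>\<^sub>m V = (of_real b :: quat) \<cdot>\<^sub>m V"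
  shows "X = of_real (b - a) \<cdot>\<^sub>m V"
proof (rule eq_matI)
  fix i j assume "i < dim_row (of_real (b - a) \<cdot>\<^sub>m V)" "j < dim_col (of_real (b - a) \<cdot>\<^sub>m V)"
  then have ij: "i < n" "j < m" using assms(2) by auto
  have "(X + of_real a \<cdot>\<^sub>m V) $$ (i, j) = (of_real b \<cdot>\<^sub>m V) $$ (i, j)" by (simp only: assms(3))
  then show "X $$ (i, j) = (of_real (b - a) \<cdot>\<^sub>m V) $$ (i, j)"
    using ij assms(1,2) by (simp add: left_diff_distrib eq_diff_eq)
qed (use assms in auto)

lemma mat_eq_0_if_cols_eq_0:
  fixes M :: "'a :: semiring_1 mat"
  assumes M: "M \<in> carrier_mat m n" and 0: "\<And>u. u \<in> carrier_mat n 1 \<Longrightarrow> M * u = 0\<^sub>m m 1"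
  shows "M = 0\<^sub>m m n"
proof (rule eq_matI)
  fix i j assume "i < dim_row (0\<^sub>m m n)" "j < dim_col (0\<^sub>m m n)"
  then have ij: "i < m" "j < n" by auto
  let ?e = "mat n 1 (\<lambda>(l, _). if l = j then 1 else 0 :: 'a)"
  have "(M * ?e) $$ (i, 0) = (\<Sum>l<n. M $$ (i, l) * (if l = j then 1 else 0))"
    by (subst index_mult_mat_of_fun[OF M ij(1)]) auto
  also have "\<dots> = (\<Sum>l<n. if l = j then M $$ (i, l) else 0)" by (rule sum.cong) auto
  also have "\<dots> = M $$ (i, j)" using ij by simp
  finally show "M $$ (i, j) = 0\<^sub>m m n $$ (i, j)" using ij by (simp add: 0)
qed (use M in auto)

section \<open>Compression to orthogonal complements\<close>

text \<open>
  For a singular pair \<open>(x, z)\<close> of \<open>M\<close>, both the span of \<open>x\<close> and its orthogonal complement are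
  respected by \<open>M\<close>, so \<open>M\<close> is the sum of its compression to the complements and a rank-one
  term. Inserting the two resolutions of the identity leaves no mixed terms.
\<close>

lemma compress_split:
  assumes c: "M \<in> carrier_mat m n" "Z \<in> carrier_mat m m'" "z \<in> carrier_mat m 1"
      "X \<in> carrier_mat n n'" "x \<in> carrier_mat n 1"
    and Z: "Z * Z\<^sup>\<dagger> + z * z\<^sup>\<dagger> = 1\<^sub>m m" "Z\<^sup>\<dagger> * z = 0\<^sub>m m' 1"
    and X: "X * X\<^sup>\<dagger> + x * x\<^sup>\<dagger> = 1\<^sub>m n"
    and r: "M * x = of_real a \<cdot>\<^sub>m z" "M\<^sup>\<dagger> * z = of_real a \<cdot>\<^sub>m x"
  shows "M = Z * (Z\<^sup>\<dagger> * M * X) * X\<^sup>\<dagger> + of_real a \<cdot>\<^sub>m (z * x\<^sup>\<dagger>)"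
proof -
  have zM: "z\<^sup>\<dagger> * M = of_real a \<cdot>\<^sub>m x\<^sup>\<dagger>"
  proof -
    have "z\<^sup>\<dagger> * M = (M\<^sup>\<dagger> * z)\<^sup>\<dagger>" using c by (subst conj_transpose_mult) auto
    then show ?thesis by (simp add: r conj_transpose_smult_of_real)
  qed
  have ZMx: "Z\<^sup>\<dagger> * M * x = 0\<^sub>m m' 1"
  proof -
    have "Z\<^sup>\<dagger> * M * x = Z\<^sup>\<dagger> * (M * x)" using c by (intro mat_mult_assoc) auto
    also have "\<dots> = of_real a \<cdot>\<^sub>m (Z\<^sup>\<dagger> * z)" unfolding r using c by (intro mat_mult_smult_of_real) auto
    finally show ?thesis by (simp add: Z)
  qed
  have "M = (Z * Z\<^sup>\<dagger> + z * z\<^sup>\<dagger>) * M" using c Z by simp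
  also have "\<dots> = Z * (Z\<^sup>\<dagger> * M) + z * (z\<^sup>\<dagger> * M)"
    using c by (simp add: mat_add_mult_distrib mat_mult_assoc)
  also have "z * (z\<^sup>\<dagger> * M) = of_real a \<cdot>\<^sub>m (z * x\<^sup>\<dagger>)"
    unfolding zM using c by (intro mat_mult_smult_of_real) auto
  also have "Z\<^sup>\<dagger> * M = Z\<^sup>\<dagger> * M * (X * X\<^sup>\<dagger> + x * x\<^sup>\<dagger>)" using c X by simp
  also have "\<dots> = Z\<^sup>\<dagger> * M * X * X\<^sup>\<dagger> + Z\<^sup>\<dagger> * M * x * x\<^sup>\<dagger>"
    using c by (simp add: mat_mult_add_distrib mat_mult_assoc)
  also have "\<dots> = Z\<^sup>\<dagger> * M * X * X\<^sup>\<dagger>" unfolding ZMx using c by simp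
  finally have "M = Z * (Z\<^sup>\<dagger> * M * X * X\<^sup>\<dagger>) + of_real a \<cdot>\<^sub>m (z * x\<^sup>\<dagger>)" .
  moreover have "Z * (Z\<^sup>\<dagger> * M * X) * X\<^sup>\<dagger> = Z * (Z\<^sup>\<dagger> * M * X * X\<^sup>\<dagger>)"
    using c by (intro mat_mult_assoc) auto
  ultimately show ?thesis by simp
qed

text \<open>
  Compressing \<open>M\<close> and \<open>N\<close> before or after multiplication differs by a term through \<open>M x\<close>, which
  is a multiple of \<open>z\<close> and is annihilated by \<open>Z\<^sup>\<dagger>\<close>. Hence the relations between the blocks of
  a unitary matrix are inherited by the compressed blocks.
\<close>

lemma compress_product:
  assumes c: "M \<in> carrier_mat m n" "N \<in> carrier_mat m2 n" "Z \<in> carrier_mat m m'" "z \<in> carrier_mat m 1"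
      "Y \<in> carrier_mat m2 m2'" "X \<in> carrier_mat n n'" "x \<in> carrier_mat n 1"
    and X: "X * X\<^sup>\<dagger> + x * x\<^sup>\<dagger> = 1\<^sub>m n"
    and Z: "Z\<^sup>\<dagger> * z = 0\<^sub>m m' 1" and r: "M * x = of_real a \<cdot>\<^sub>m z"
  shows "(Z\<^sup>\<dagger> * M * X) * (Y\<^sup>\<dagger> * N * X)\<^sup>\<dagger> = Z\<^sup>\<dagger> * (M * N\<^sup>\<dagger>) * Y"
proof -
  have ZMx: "Z\<^sup>\<dagger> * M * x = 0\<^sub>m m' 1"
  proof -
    have "Z\<^sup>\<dagger> * M * x = Z\<^sup>\<dagger> * (M * x)" using c by (intro mat_mult_assoc) auto
    also have "\<dots> = of_real a \<cdot>\<^sub>m (Z\<^sup>\<dagger> * z)" unfolding r using c by (intro mat_mult_smult_of_real) auto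
    finally show ?thesis by (simp add: Z)
  qed
  have "Z\<^sup>\<dagger> * (M * N\<^sup>\<dagger>) * Y = Z\<^sup>\<dagger> * M * (X * X\<^sup>\<dagger> + x * x\<^sup>\<dagger>) * (N\<^sup>\<dagger> * Y)"
    unfolding X using c by (simp add: mat_mult_assoc)
  also have "\<dots> = (Z\<^sup>\<dagger> * M * X) * (Y\<^sup>\<dagger> * N * X)\<^sup>\<dagger> + Z\<^sup>\<dagger> * M * x * (x\<^sup>\<dagger> * (N\<^sup>\<dagger> * Y))"
    using c by (simp add: mat_algebra)
  also have "\<dots> = (Z\<^sup>\<dagger> * M * X) * (Y\<^sup>\<dagger> * N * X)\<^sup>\<dagger>"
    unfolding ZMx using c by simp
  finally show ?thesis by simp
qed

lemma compress_unitary_blocks: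
  assumes A: "unitary_blocks j k \<alpha> T \<beta> P"
    and z: "z \<in> carrier_mat j 1" "Z \<in> carrier_mat j j'" "Z\<^sup>\<dagger> * z = 0\<^sub>m j' 1" "Z\<^sup>\<dagger> * Z = 1\<^sub>m j'"
    and w: "w \<in> carrier_mat j 1" "W \<in> carrier_mat j j'" "W * W\<^sup>\<dagger> + w * w\<^sup>\<dagger> = 1\<^sub>m j"
    and x: "x \<in> carrier_mat k 1" "X \<in> carrier_mat k k'" "X * X\<^sup>\<dagger> + x * x\<^sup>\<dagger> = 1\<^sub>m k"
    and y: "y \<in> carrier_mat k 1" "Y \<in> carrier_mat k k'" "Y\<^sup>\<dagger> * y = 0\<^sub>m k' 1" "Y\<^sup>\<dagger> * Y = 1\<^sub>m k'"
    and r: "\<alpha> * w = of_real c1 \<cdot>\<^sub>m z" "T * x = of_real c2 \<cdot>\<^sub>m z"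
      "\<beta> * w = of_real c3 \<cdot>\<^sub>m y" "P * x = of_real c4 \<cdot>\<^sub>m y"
  shows "unitary_blocks j' k' (Z\<^sup>\<dagger> * \<alpha> * W) (Z\<^sup>\<dagger> * T * X) (Y\<^sup>\<dagger> * \<beta> * W) (Y\<^sup>\<dagger> * P * X)"
proof -
  note c = unitary_blocks_carrier[OF A]
  note A' = A[unfolded unitary_blocks_iff]
  have *: "U\<^sup>\<dagger> * K * V + U\<^sup>\<dagger> * L * V = U\<^sup>\<dagger> * (K + L) * V"
    if "U \<in> carrier_mat n n'" "K \<in> carrier_mat n m" "L \<in> carrier_mat n m" "V \<in> carrier_mat m m'"
    for U K L V and n n' m m' :: nat
    using that by (simp add: mat_algebra)
  have "(Z\<^sup>\<dagger> * \<alpha> * W) * (Z\<^sup>\<dagger> * \<alpha> * W)\<^sup>\<dagger> + (Z\<^sup>\<dagger> * T * X) * (Z\<^sup>\<dagger> * T * X)\<^sup>\<dagger> = Z\<^sup>\<dagger> * (\<alpha> * \<alpha>\<^sup>\<dagger> + T * T\<^sup>\<dagger>) * Z"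
    unfolding compress_product[OF c(1) c(1) z(2,1) z(2) w(2,1,3) z(3) r(1)]
      compress_product[OF c(2) c(2) z(2,1) z(2) x(2,1,3) z(3) r(2)]
    using c z(2) by (intro *[of _ j j']) auto
  moreover have "(Z\<^sup>\<dagger> * \<alpha> * W) * (Y\<^sup>\<dagger> * \<beta> * W)\<^sup>\<dagger> + (Z\<^sup>\<dagger> * T * X) * (Y\<^sup>\<dagger> * P * X)\<^sup>\<dagger> = Z\<^sup>\<dagger> * (\<alpha> * \<beta>\<^sup>\<dagger> + T * P\<^sup>\<dagger>) * Y"
    unfolding compress_product[OF c(1) c(3) z(2,1) y(2) w(2,1,3) z(3) r(1)]
      compress_product[OF c(2) c(4) z(2,1) y(2) x(2,1,3) z(3) r(2)]
    using c z(2) y(2) by (intro *[of _ j j']) auto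
  moreover have "(Y\<^sup>\<dagger> * \<beta> * W) * (Z\<^sup>\<dagger> * \<alpha> * W)\<^sup>\<dagger> + (Y\<^sup>\<dagger> * P * X) * (Z\<^sup>\<dagger> * T * X)\<^sup>\<dagger> = Y\<^sup>\<dagger> * (\<beta> * \<alpha>\<^sup>\<dagger> + P * T\<^sup>\<dagger>) * Z"
    unfolding compress_product[OF c(3) c(1) y(2,1) z(2) w(2,1,3) y(3) r(3)]
      compress_product[OF c(4) c(2) y(2,1) z(2) x(2,1,3) y(3) r(4)]
    using c z(2) y(2) by (intro *[of _ k k']) auto
  moreover have "(Y\<^sup>\<dagger> * \<beta> * W) * (Y\<^sup>\<dagger> * \<beta> * W)\<^sup>\<dagger> + (Y\<^sup>\<dagger> * P * X) * (Y\<^sup>\<dagger> * P * X)\<^sup>\<dagger> = Y\<^sup>\<dagger> * (\<beta> * \<beta>\<^sup>\<dagger> + P * P\<^sup>\<dagger>) * Y"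
    unfolding compress_product[OF c(3) c(3) y(2,1) y(2) w(2,1,3) y(3) r(3)]
      compress_product[OF c(4) c(4) y(2,1) y(2) x(2,1,3) y(3) r(4)]
    using c y(2) by (intro *[of _ k k']) auto
  ultimately show ?thesis
    using A' z w x y c unfolding unitary_blocks_iff by (auto intro!: mult_carrier_mat)
qed

section \<open>Splitting off a plane rotation\<close>

abbreviation smult_real :: "real \<Rightarrow> quat mat \<Rightarrow> quat mat" (infixr "\<cdot>\<^sub>r" 75) where
  "c \<cdot>\<^sub>r X \<equiv> of_real c \<cdot>\<^sub>m X"

lemma smult_real_0: "X \<in> carrier_mat n m \<Longrightarrow> 0 \<cdot>\<^sub>r X = 0\<^sub>m n m"
  by (auto intro!: eq_matI)

lemma smult_real_1: "1 \<cdot>\<^sub>r X = X"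
  by simp

lemma sum_of_products_mult:
  assumes "M \<in> carrier_mat a b" "M' \<in> carrier_mat b c" "N \<in> carrier_mat a d" "N' \<in> carrier_mat d c"
    "u \<in> carrier_mat c e"
  shows "(M * M' + N * N') * u = M * (M' * u) + N * (N' * u :: 'a :: semiring_0 mat)"
  using assms by (simp add: mat_add_mult_distrib mat_mult_assoc)

text \<open>
  Written as a matrix acting on pairs of columns, \<open>A\<close> sends \<open>(w, 0)\<close> to \<open>(cos t z, sin t y)\<close> and
  \<open>(0, x)\<close> to \<open>(- sin t z, cos t y)\<close>; the relations with adjoints say that the inverse of \<open>A\<close>
  undoes this.
\<close>

definition cs_vectors :: "nat \<Rightarrow> nat \<Rightarrow> quat mat \<Rightarrow> quat mat \<Rightarrow> quat mat \<Rightarrow> quat mat \<Rightarrow> real \<Rightarrow>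
    quat mat \<Rightarrow> quat mat \<Rightarrow> quat mat \<Rightarrow> quat mat \<Rightarrow> bool" where
  "cs_vectors j k \<alpha> T \<beta> P t w x z y \<longleftrightarrow>
    w \<in> carrier_mat j 1 \<and> x \<in> carrier_mat k 1 \<and> z \<in> carrier_mat j 1 \<and> y \<in> carrier_mat k 1 \<and>
    col_norm2 w = 1 \<and> col_norm2 x = 1 \<and> col_norm2 z = 1 \<and> col_norm2 y = 1 \<and>
    \<alpha> * w = cos t \<cdot>\<^sub>r z \<and> \<alpha>\<^sup>\<dagger> * z = cos t \<cdot>\<^sub>r w \<and> T * x = (- sin t) \<cdot>\<^sub>r z \<and> T\<^sup>\<dagger> * z = (- sin t) \<cdot>\<^sub>r x \<and>
    \<beta> * w = sin t \<cdot>\<^sub>r y \<and> \<beta>\<^sup>\<dagger> * y = sin t \<cdot>\<^sub>r w \<and> P * x = cos t \<cdot>\<^sub>r y \<and> P\<^sup>\<dagger> * y = cos t \<cdot>\<^sub>r x"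

text \<open>
  The column \<open>x\<close> maximises the norm of \<open>T x\<close>, the column \<open>z\<close> is the normalised image with the
  sign reversed, and \<open>w\<close> and \<open>y\<close> are the normalised images of \<open>z\<close> and \<open>x\<close> under \<open>\<alpha>\<^sup>\<dagger>\<close> and \<open>P\<close>. When
  \<open>cos t = 0\<close> these images vanish. Then \<open>\<alpha>\<close> is singular because its adjoint is, \<open>w\<close> can be any
  unit column of its kernel, and \<open>y\<close> is the image of \<open>w\<close> under \<open>\<beta>\<close>. If \<open>t < \<pi>/2\<close>, then \<open>T\<close> strictly
  decreases the norm of nonzero columns, so \<open>P\<close> cannot annihilate any of them.
\<close>

lemma exists_cs_vectors:
  assumes A: "unitary_blocks j k \<alpha> T \<beta> P" and T: "T \<noteq> 0\<^sub>m j k"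
  shows "\<exists>t w x z y. 0 < t \<and> t \<le> pi / 2 \<and> cs_vectors j k \<alpha> T \<beta> P t w x z y \<and>
    (t < pi / 2 \<longrightarrow> (\<forall>u \<in> carrier_mat k 1. P * u = 0\<^sub>m k 1 \<longrightarrow> u = 0\<^sub>m k 1))"
proof -
  note c = unitary_blocks_carrier[OF A]
  note row = A[unfolded unitary_blocks_iff]
  note col = unitary_blocks_adjoint_products[OF A]
  have "0 < k"
  proof (rule ccontr)
    assume "\<not> 0 < k"
    with c(2) have "T = 0\<^sub>m j k" by (intro eq_matI) auto
    with T show False by (rule notE)
  qed
  obtain x where x: "x \<in> carrier_mat k 1" "col_norm2 x = 1"
    and bnd: "\<forall>u \<in> carrier_mat k 1. col_norm2 (T * u) \<le> col_norm2 (T * x) * col_norm2 u"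
    using exists_maximal_unit_col[OF c(2) \<open>0 < k\<close>] by (elim bexE conjE)
  define \<sigma> where "\<sigma> = col_norm2 (T * x)"
  note bound = bnd[folded \<sigma>_def, rule_format]
  have Tx: "T * x \<in> carrier_mat j 1" and Px: "P * x \<in> carrier_mat k 1" using c x by auto
  have "\<sigma> \<noteq> 0"
  proof
    assume "\<sigma> = 0"
    have "T = 0\<^sub>m j k"
    proof (rule mat_eq_0_if_cols_eq_0[OF c(2)])
      fix u :: "quat mat" assume u: "u \<in> carrier_mat k 1"
      have Tu: "T * u \<in> carrier_mat j 1" using c u by auto
      have "col_norm2 (T * u) = 0"
        using bound[OF u] col_norm2_nonneg[OF Tu] \<open>\<sigma> = 0\<close> by simp
      then show "T * u = 0\<^sub>m j 1" using col_norm2_eq_0_iff[OF Tu] by (rule iffD1[rotated])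
    qed
    with T show False by (rule notE)
  qed
  then have "0 < \<sigma>" using col_norm2_nonneg[OF Tx] by (simp add: \<sigma>_def)
  have eig: "T\<^sup>\<dagger> * (T * x) = \<sigma> \<cdot>\<^sub>r x"
    using maximal_col_is_eigenvector[OF c(2) \<open>0 < \<sigma>\<close> bound x \<sigma>_def[symmetric]] .
  note pythTP = pythagoras_isometric_pair[OF c(2) c(4) _ col(4)]
  have NPx: "col_norm2 (P * x) = 1 - \<sigma>" using pythTP(2)[OF x(1)] x(2) by (simp add: \<sigma>_def)
  then have "\<sigma> \<le> 1" using col_norm2_nonneg[OF Px] by simp
  then have "\<exists>t. 0 \<le> t \<and> t \<le> pi / 2 \<and> sqrt (1 - \<sigma>) = cos t \<and> sqrt \<sigma> = sin t"
    using \<open>0 < \<sigma>\<close> by (intro sincos_total_pi_half) simp_all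
  then obtain t where t: "0 \<le> t" "t \<le> pi / 2" "sqrt (1 - \<sigma>) = cos t" "sqrt \<sigma> = sin t"
    by (elim exE conjE)
  have s: "0 < sin t" "(sin t)\<^sup>2 = \<sigma>" and c2: "(cos t)\<^sup>2 = 1 - \<sigma>" "0 \<le> cos t"
    using \<open>0 < \<sigma>\<close> \<open>\<sigma> \<le> 1\<close> by (simp_all add: t(3,4)[symmetric])
  have "0 < t" using s(1) t(1) by (cases "t = 0") auto
  \<comment> \<open>The real scalars that occur when \<open>z\<close> is expressed by \<open>T x\<close> and conversely.\<close>
  have sdiv: "(- 1 / sin t) * \<sigma> = - sin t" "(- sin t) * (- 1 / sin t) = 1" "(-1 / sin t)\<^sup>2 * \<sigma> = 1"
    using s(1) by (simp_all add: s(2)[symmetric] power2_eq_square)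
  define z where "z = (- 1 / sin t) \<cdot>\<^sub>r (T * x)"
  have z: "z \<in> carrier_mat j 1" using Tx by (simp add: z_def)
  have Tx_z: "T * x = (- sin t) \<cdot>\<^sub>r z"
    unfolding z_def smult_of_real_smult sdiv smult_real_1 ..
  have Nz: "col_norm2 z = 1"
    unfolding z_def col_norm2_smult[OF Tx] \<sigma>_def[symmetric] by (rule sdiv)
  have Tz: "T\<^sup>\<dagger> * z = (- sin t) \<cdot>\<^sub>r x"
  proof -
    have "T\<^sup>\<dagger> * z = (- 1 / sin t) \<cdot>\<^sub>r (T\<^sup>\<dagger> * (T * x))"
      unfolding z_def using c x by (intro mat_mult_smult_of_real) auto
    then show ?thesis unfolding eig smult_of_real_smult sdiv .
  qed
  define v where "v = \<alpha>\<^sup>\<dagger> * z"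
  have v: "v \<in> carrier_mat j 1" using c z by (simp add: v_def)
  have \<alpha>T: "(\<alpha>\<^sup>\<dagger>)\<^sup>\<dagger> * \<alpha>\<^sup>\<dagger> + (T\<^sup>\<dagger>)\<^sup>\<dagger> * T\<^sup>\<dagger> = 1\<^sub>m j" using row by simp
  note pyth\<alpha>T = pythagoras_isometric_pair[of "\<alpha>\<^sup>\<dagger>" j j "T\<^sup>\<dagger>" k z, OF _ _ z \<alpha>T]
  have Nv: "col_norm2 v = 1 - \<sigma>"
  proof -
    have "col_norm2 v + col_norm2 (T\<^sup>\<dagger> * z) = col_norm2 z" using pyth\<alpha>T(2) c by (simp add: v_def)
    then show ?thesis unfolding Tz col_norm2_smult[OF x(1)] by (simp add: s x Nz)
  qed
  have \<alpha>v: "\<alpha> * v = (1 - \<sigma>) \<cdot>\<^sub>r z"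
  proof (rule add_smult_cancel[of _ j 1])
    have "T * (T\<^sup>\<dagger> * z) = (- sin t) \<cdot>\<^sub>r (T * x)"
      unfolding Tz using c x by (intro mat_mult_smult_of_real) auto
    then have "T * (T\<^sup>\<dagger> * z) = \<sigma> \<cdot>\<^sub>r z"
      unfolding Tx_z smult_of_real_smult by (simp only: s(2)[symmetric] power2_eq_square minus_mult_minus)
    moreover have "\<alpha> * v + T * (T\<^sup>\<dagger> * z) = z" using pyth\<alpha>T(1) c by (simp add: v_def)
    ultimately show "\<alpha> * v + \<sigma> \<cdot>\<^sub>r z = 1 \<cdot>\<^sub>r z" by simp
  qed (use c v z in auto)
  have \<beta>v: "\<beta> * v = sin t \<cdot>\<^sub>r (P * x)"
  proof -
    have "(\<beta> * \<alpha>\<^sup>\<dagger> + P * T\<^sup>\<dagger>) * z = \<beta> * v + P * (T\<^sup>\<dagger> * z)"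
      unfolding v_def using c z by (intro sum_of_products_mult) auto
    moreover have "(\<beta> * \<alpha>\<^sup>\<dagger> + P * T\<^sup>\<dagger>) * z = 0 \<cdot>\<^sub>r (P * x)"
      using row z unfolding smult_real_0[OF Px] by simp
    moreover have "P * (T\<^sup>\<dagger> * z) = (- sin t) \<cdot>\<^sub>r (P * x)"
      unfolding Tz using c x by (intro mat_mult_smult_of_real) auto
    ultimately have "\<beta> * v + (- sin t) \<cdot>\<^sub>r (P * x) = 0 \<cdot>\<^sub>r (P * x)" by (simp only:)
    then have "\<beta> * v = (0 - - sin t) \<cdot>\<^sub>r (P * x)"
      using c v Px by (intro add_smult_cancel[of _ k 1]) auto
    then show ?thesis by simp
  qed
  have PPx: "P\<^sup>\<dagger> * (P * x) = (1 - \<sigma>) \<cdot>\<^sub>r x"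
  proof (rule add_smult_cancel[of _ k 1])
    have "P\<^sup>\<dagger> * (P * x) + \<sigma> \<cdot>\<^sub>r x = \<sigma> \<cdot>\<^sub>r x + P\<^sup>\<dagger> * (P * x)"
      using c x Px by (intro comm_add_mat) auto
    then show "P\<^sup>\<dagger> * (P * x) + \<sigma> \<cdot>\<^sub>r x = 1 \<cdot>\<^sub>r x"
      using pythTP(1)[OF x(1)] unfolding eig by simp
  qed (use c x Px in auto)
  have \<beta>Px: "\<beta>\<^sup>\<dagger> * (P * x) = sin t \<cdot>\<^sub>r v"
  proof -
    have "(\<alpha>\<^sup>\<dagger> * T + \<beta>\<^sup>\<dagger> * P) * x = \<alpha>\<^sup>\<dagger> * (T * x) + \<beta>\<^sup>\<dagger> * (P * x)"
      using c x by (intro sum_of_products_mult) auto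
    moreover have "\<alpha>\<^sup>\<dagger> * (T * x) + \<beta>\<^sup>\<dagger> * (P * x) = \<beta>\<^sup>\<dagger> * (P * x) + \<alpha>\<^sup>\<dagger> * (T * x)"
      using c x Tx Px by (intro comm_add_mat) auto
    moreover have "(\<alpha>\<^sup>\<dagger> * T + \<beta>\<^sup>\<dagger> * P) * x = 0 \<cdot>\<^sub>r v"
      using x unfolding col smult_real_0[OF v] by simp
    moreover have "\<alpha>\<^sup>\<dagger> * (T * x) = (- sin t) \<cdot>\<^sub>r v"
      unfolding Tx_z v_def using c z by (intro mat_mult_smult_of_real) auto
    ultimately have "\<beta>\<^sup>\<dagger> * (P * x) + (- sin t) \<cdot>\<^sub>r v = 0 \<cdot>\<^sub>r v" by (simp only:)
    then have "\<beta>\<^sup>\<dagger> * (P * x) = (0 - - sin t) \<cdot>\<^sub>r v"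
      using c v Px by (intro add_smult_cancel[of _ j 1]) auto
    then show ?thesis by simp
  qed
  have inj: "u = 0\<^sub>m k 1" if "t < pi / 2" "u \<in> carrier_mat k 1" "P * u = 0\<^sub>m k 1" for u
  proof -
    have "0 < cos t" using that(1) \<open>0 < t\<close> by (intro cos_gt_zero) auto
    then have "0 < 1 - \<sigma>" unfolding c2(1)[symmetric] by simp
    have "col_norm2 (P * u) = 0" unfolding that(3) using col_norm2_eq_0_iff[of "0\<^sub>m k 1" k] by simp
    then have "col_norm2 u \<le> \<sigma> * col_norm2 u"
      using pythTP(2)[OF that(2)] bound[OF that(2)] by simp
    then have "(1 - \<sigma>) * col_norm2 u \<le> 0" by (simp add: algebra_simps)
    then have "col_norm2 u = 0"
      using \<open>0 < 1 - \<sigma>\<close> col_norm2_nonneg[OF that(2)] by (simp add: mult_le_0_iff)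
    then show ?thesis using col_norm2_eq_0_iff[OF that(2)] by (rule iffD1[rotated])
  qed
  have "\<exists>w y. cs_vectors j k \<alpha> T \<beta> P t w x z y"
  proof (cases "cos t = 0")
    case False
    \<comment> \<open>The analogous scalars for \<open>w\<close> and \<open>y\<close>.\<close>
    have cdiv: "cos t * (1 / cos t) = 1" "(1 / cos t) * (1 - \<sigma>) = cos t" "(1 / cos t)\<^sup>2 * (1 - \<sigma>) = 1"
      "1 / cos t * sin t = sin t * (1 / cos t)"
      unfolding c2(1)[symmetric] using False by (simp_all add: power2_eq_square)
    define w where "w = (1 / cos t) \<cdot>\<^sub>r v"
    define y where "y = (1 / cos t) \<cdot>\<^sub>r (P * x)"
    have w: "w \<in> carrier_mat j 1" and y: "y \<in> carrier_mat k 1" using v Px by (auto simp: w_def y_def)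
    have "col_norm2 w = 1" "col_norm2 y = 1"
      unfolding w_def y_def col_norm2_smult[OF v] col_norm2_smult[OF Px] Nv NPx by (rule cdiv)+
    moreover have "\<alpha> * w = cos t \<cdot>\<^sub>r z"
    proof -
      have "\<alpha> * w = (1 / cos t) \<cdot>\<^sub>r (\<alpha> * v)"
        unfolding w_def using c v by (intro mat_mult_smult_of_real) auto
      then show ?thesis unfolding \<alpha>v smult_of_real_smult cdiv .
    qed
    moreover have "\<alpha>\<^sup>\<dagger> * z = cos t \<cdot>\<^sub>r w"
      unfolding w_def smult_of_real_smult cdiv smult_real_1 v_def ..
    moreover have "\<beta> * w = sin t \<cdot>\<^sub>r y"
    proof -
      have "\<beta> * w = (1 / cos t) \<cdot>\<^sub>r (\<beta> * v)"
        unfolding w_def using c v by (intro mat_mult_smult_of_real) auto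
      then show ?thesis unfolding \<beta>v y_def smult_of_real_smult cdiv .
    qed
    moreover have "\<beta>\<^sup>\<dagger> * y = sin t \<cdot>\<^sub>r w"
    proof -
      have "\<beta>\<^sup>\<dagger> * y = (1 / cos t) \<cdot>\<^sub>r (\<beta>\<^sup>\<dagger> * (P * x))"
        unfolding y_def using c Px by (intro mat_mult_smult_of_real) auto
      then show ?thesis unfolding \<beta>Px w_def smult_of_real_smult cdiv .
    qed
    moreover have "P * x = cos t \<cdot>\<^sub>r y"
      unfolding y_def smult_of_real_smult cdiv smult_real_1 ..
    moreover have "P\<^sup>\<dagger> * y = cos t \<cdot>\<^sub>r x"
    proof -
      have "P\<^sup>\<dagger> * y = (1 / cos t) \<cdot>\<^sub>r (P\<^sup>\<dagger> * (P * x))"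
        unfolding y_def using c Px by (intro mat_mult_smult_of_real) auto
      then show ?thesis unfolding PPx smult_of_real_smult cdiv .
    qed
    ultimately have "cs_vectors j k \<alpha> T \<beta> P t w x z y"
      unfolding cs_vectors_def using w x y z Nz Tx_z Tz by (intro conjI)
    then show ?thesis by (intro exI)
  next
    case True
    have "\<sigma> = 1" using c2(1) True by simp
    then have "sin t = 1" using t(4) by simp
    have v0: "v = 0\<^sub>m j 1" and Px0: "P * x = 0\<^sub>m k 1"
      using Nv NPx \<open>\<sigma> = 1\<close> col_norm2_eq_0_iff[OF v] col_norm2_eq_0_iff[OF Px] by simp_all
    have z0: "z \<noteq> 0\<^sub>m j 1"
    proof
      assume "z = 0\<^sub>m j 1"
      then have "col_norm2 z = 0" using col_norm2_eq_0_iff[OF z] by (rule iffD2[rotated])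
      with Nz show False by simp
    qed
    obtain w where w: "w \<in> carrier_mat j 1" "col_norm2 w = 1" "\<alpha> * w = 0\<^sub>m j 1"
      using square_kernel_of_adjoint_kernel[OF c(1) z z0 v0[unfolded v_def]] by (elim bexE conjE)
    define y where "y = \<beta> * w"
    have y: "y \<in> carrier_mat k 1" using c w by (simp add: y_def)
    note pyth\<alpha>\<beta> = pythagoras_isometric_pair[OF c(1,3) w(1) col(1), folded y_def]
    have "col_norm2 (0\<^sub>m j 1) = 0" using col_norm2_eq_0_iff[of "0\<^sub>m j 1" j] by simp
    then have "col_norm2 y = 1" using pyth\<alpha>\<beta>(2) w by simp
    moreover have "\<beta>\<^sup>\<dagger> * y = w" using pyth\<alpha>\<beta>(1) c y unfolding w(3) by simp
    moreover have "P\<^sup>\<dagger> * y = 0\<^sub>m k 1"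
    proof -
      have "(T\<^sup>\<dagger> * \<alpha> + P\<^sup>\<dagger> * \<beta>) * w = T\<^sup>\<dagger> * (\<alpha> * w) + P\<^sup>\<dagger> * (\<beta> * w)"
        using c w by (intro sum_of_products_mult) auto
      then show ?thesis using c w(1) y unfolding col w(3) y_def[symmetric] by simp
    qed
    moreover have "\<alpha> * w = cos t \<cdot>\<^sub>r z" "\<alpha>\<^sup>\<dagger> * z = cos t \<cdot>\<^sub>r w" "P * x = cos t \<cdot>\<^sub>r y"
      using w(3) v0 Px0 smult_real_0[OF z] smult_real_0[OF w(1)] smult_real_0[OF y]
      by (simp_all only: True v_def of_real_0)
    moreover have "\<beta> * w = sin t \<cdot>\<^sub>r y"
      by (simp only: \<open>sin t = 1\<close> smult_real_1 y_def)
    ultimately have "cs_vectors j k \<alpha> T \<beta> P t w x z y"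
      unfolding cs_vectors_def
      using w x y z Nz Tx_z Tz smult_real_0[OF x(1)]
      by (simp only: True \<open>sin t = 1\<close> smult_real_1)
    then show ?thesis by (intro exI)
  qed
  then obtain w y where wy: "cs_vectors j k \<alpha> T \<beta> P t w x z y" by (elim exE)
  have inj_all: "t < pi / 2 \<longrightarrow> (\<forall>u \<in> carrier_mat k 1. P * u = 0\<^sub>m k 1 \<longrightarrow> u = 0\<^sub>m k 1)"
    by (intro impI ballI) (rule inj; assumption)
  show ?thesis
    by (rule exI[of _ t], rule exI[of _ w], rule exI[of _ x], rule exI[of _ z],
        rule exI[of _ y])
      (intro conjI \<open>0 < t\<close> t(2) wy inj_all)
qed

section \<open>The decomposition\<close>

text \<open>
  The middle factors of all four blocks have this shape: \<open>E\<close> is an identity matrix or a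
  rectangular zero matrix, and \<open>f\<close> runs through cosines or signed sines. The matrix need not
  be square, since \<open>E\<close> may have size \<open>p' \<times> p\<close>.
\<close>

definition cs_blk :: "quat mat \<Rightarrow> nat \<Rightarrow> (nat \<Rightarrow> real) \<Rightarrow> quat mat" where
  "cs_blk E N f = four_block_mat E (0\<^sub>m (dim_row E) N) (0\<^sub>m N (dim_col E)) (mat_diag N (\<lambda>i. of_real (f i)))"

lemma cs_blk_carrier [simp]: "E \<in> carrier_mat p' p \<Longrightarrow> cs_blk E N f \<in> carrier_mat (p' + N) (p + N)"
  by (auto simp: cs_blk_def mat_diag_def)

lemma cs_blk_0: "cs_blk E 0 f = E"
  by (rule eq_matI) (auto simp: cs_blk_def mat_diag_def)

lemma cs_blk_Suc:
  assumes "E \<in> carrier_mat p' p"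
  shows "cs_blk E (Suc N) (f(N := c)) =
    four_block_mat (cs_blk E N f) (0\<^sub>m (p' + N) 1) (0\<^sub>m 1 (p + N)) (c \<cdot>\<^sub>r 1\<^sub>m 1)"
  using assms by (intro eq_matI) (auto simp: cs_blk_def mat_diag_def)

text \<open>
  This merges the angles in the open interval and the right angles into one diagonal.
\<close>

lemma diag_block_mat_eq_cs_blk:
  assumes "F = mat_diag q (\<lambda>i. of_real (f i))" "G = mat_diag r (\<lambda>i. of_real (f (q + i)))"
  shows "diag_block_mat [E, F, G] = cs_blk E (q + r) f"
  unfolding assms by (rule eq_matI) (auto simp: cs_blk_def mat_diag_def Let_def)

lemma snoc_col_Sp:
  assumes "Z \<in> carrier_mat (Suc n) n" "Z\<^sup>\<dagger> * Z = 1\<^sub>m n" "Z\<^sup>\<dagger> * z = 0\<^sub>m n 1"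
    and z: "z \<in> carrier_mat (Suc n) 1" "col_norm2 z = 1" and "U \<in> Sp n"
  shows "snoc_col (Z * U) z \<in> Sp (Suc n)"
proof -
  note U = SpD[OF \<open>U \<in> Sp n\<close>]
  have ZU: "Z * U \<in> carrier_mat (Suc n) n" using assms(1) U(1) by (rule mult_carrier_mat)
  have "(Z * U)\<^sup>\<dagger> * (Z * U) = U\<^sup>\<dagger> * (Z\<^sup>\<dagger> * Z * U)"
    using assms(1) U(1) by (simp add: mat_algebra)
  then have "(Z * U)\<^sup>\<dagger> * (Z * U) = 1\<^sub>m n" unfolding assms(2) using U by simp
  moreover have "(Z * U)\<^sup>\<dagger> * z = U\<^sup>\<dagger> * (Z\<^sup>\<dagger> * z)"
    using assms(1) U(1) z by (simp add: mat_algebra)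
  then have "(Z * U)\<^sup>\<dagger> * z = 0\<^sub>m n 1" unfolding assms(3) using U by simp
  ultimately have "(snoc_col (Z * U) z)\<^sup>\<dagger> * snoc_col (Z * U) z = 1\<^sub>m (Suc n)"
    using ZU z unit_col_iff[OF z(1)] by (intro snoc_col_isometry) auto
  then show ?thesis using ZU z by (intro SpI) auto
qed

lemma snoc_col_cs_blk:
  assumes E: "E \<in> carrier_mat p' p" and c: "Z \<in> carrier_mat m (p' + N)" "U \<in> carrier_mat (p' + N) (p' + N)"
      "z \<in> carrier_mat m 1" "W \<in> carrier_mat n (p + N)" "V \<in> carrier_mat (p + N) (p + N)" "w \<in> carrier_mat n 1"
    and M: "M = Z * (Z\<^sup>\<dagger> * M * W) * W\<^sup>\<dagger> + c \<cdot>\<^sub>r (z * w\<^sup>\<dagger>)"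
    and D: "Z\<^sup>\<dagger> * M * W = U * cs_blk E N f * V\<^sup>\<dagger>"
  shows "M = snoc_col (Z * U) z * cs_blk E (Suc N) (f(N := c)) * (snoc_col (W * V) w)\<^sup>\<dagger>"
proof -
  have "snoc_col (Z * U) z * cs_blk E (Suc N) (f(N := c)) * (snoc_col (W * V) w)\<^sup>\<dagger>
     = Z * U * cs_blk E N f * (W * V)\<^sup>\<dagger> + c \<cdot>\<^sub>r (z * w\<^sup>\<dagger>)"
    unfolding cs_blk_Suc[OF E]
    using c E by (intro snoc_col_block_product mult_carrier_mat) auto
  also have "Z * U * cs_blk E N f * (W * V)\<^sup>\<dagger> = Z * (U * cs_blk E N f * V\<^sup>\<dagger>) * W\<^sup>\<dagger>"
    using c cs_blk_carrier[OF E, of N f] by (simp add: mat_algebra)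
  finally show ?thesis by (rule trans[OF M[unfolded D] sym])
qed

definition cs_form :: "nat \<Rightarrow> nat \<Rightarrow> nat \<Rightarrow> (nat \<Rightarrow> real) \<Rightarrow> quat mat \<Rightarrow> quat mat \<Rightarrow> quat mat \<Rightarrow> quat mat \<Rightarrow>
    quat mat \<Rightarrow> quat mat \<Rightarrow> quat mat \<Rightarrow> quat mat \<Rightarrow> bool" where
  "cs_form p p' N \<theta> a b m l \<alpha> T \<beta> P \<longleftrightarrow>
    a \<in> Sp (p + N) \<and> b \<in> Sp (p + N) \<and> m \<in> Sp (p' + N) \<and> l \<in> Sp (p' + N) \<and>
    \<alpha> = m * cs_blk (1\<^sub>m p') N (\<lambda>i. cos (\<theta> i)) * l\<^sup>\<dagger> \<and>
    T = m * cs_blk (0\<^sub>m p' p) N (\<lambda>i. - sin (\<theta> i)) * b\<^sup>\<dagger> \<and>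
    \<beta> = a * cs_blk (0\<^sub>m p p') N (\<lambda>i. sin (\<theta> i)) * l\<^sup>\<dagger> \<and>
    P = a * cs_blk (1\<^sub>m p) N (\<lambda>i. cos (\<theta> i)) * b\<^sup>\<dagger>"

text \<open>
  With \<open>T = 0\<close> the first block row shows that \<open>\<alpha>\<close> is unitary, and the mixed relation \<open>\<alpha> \<beta>\<^sup>\<dagger> = 0\<close>
  then gives \<open>\<beta> = 0\<close>.
\<close>

lemma cs_form_of_zero_corner:
  assumes A: "unitary_blocks j k \<alpha> T \<beta> P" and T: "T = 0\<^sub>m j k"
  shows "cs_form k j 0 \<theta> P (1\<^sub>m k) \<alpha> (1\<^sub>m j) \<alpha> T \<beta> P"
proof -
  note c = unitary_blocks_carrier[OF A]
  note row = A[unfolded unitary_blocks_iff]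
  have "\<alpha> * \<alpha>\<^sup>\<dagger> = 1\<^sub>m j" using row c unfolding T by simp
  then have \<alpha>: "\<alpha> \<in> Sp j" using c by (simp add: Sp_def)
  have "\<alpha> * \<beta>\<^sup>\<dagger> = 0\<^sub>m j k" using row c unfolding T by simp
  moreover have "\<alpha>\<^sup>\<dagger> * \<alpha> * \<beta>\<^sup>\<dagger> = \<alpha>\<^sup>\<dagger> * (\<alpha> * \<beta>\<^sup>\<dagger>)" using c by (intro mat_mult_assoc) auto
  ultimately have "\<beta>\<^sup>\<dagger> = 0\<^sub>m j k" using c SpD(3)[OF \<alpha>] by simp
  then have "(\<beta>\<^sup>\<dagger>)\<^sup>\<dagger> = (0\<^sub>m j k)\<^sup>\<dagger>" by (simp only:)
  then have \<beta>: "\<beta> = 0\<^sub>m k j" by simp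
  have "P * P\<^sup>\<dagger> = 1\<^sub>m k" using row c unfolding \<beta> by simp
  then have P: "P \<in> Sp k" using c by (simp add: Sp_def)
  show ?thesis
    unfolding cs_form_def cs_blk_0 using \<alpha> P \<beta> T c by (simp add: Sp_def)
qed

text \<open>
  The unitary factors of the compressed blocks are transported by the orthonormal bases \<open>W\<close>,
  \<open>X\<close>, \<open>Z\<close>, \<open>Y\<close> of the complements and completed by the columns of the plane rotation, whose
  angle becomes the last entry.
\<close>

lemma cs_form_extend:
  assumes A: "unitary_blocks (Suc j) (Suc k) \<alpha> T \<beta> P"
    and vec: "cs_vectors (Suc j) (Suc k) \<alpha> T \<beta> P t w x z y"
    and W: "W \<in> carrier_mat (Suc j) j" "W\<^sup>\<dagger> * W = 1\<^sub>m j" "W\<^sup>\<dagger> * w = 0\<^sub>m j 1" "W * W\<^sup>\<dagger> + w * w\<^sup>\<dagger> = 1\<^sub>m (Suc j)"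
    and X: "X \<in> carrier_mat (Suc k) k" "X\<^sup>\<dagger> * X = 1\<^sub>m k" "X\<^sup>\<dagger> * x = 0\<^sub>m k 1" "X * X\<^sup>\<dagger> + x * x\<^sup>\<dagger> = 1\<^sub>m (Suc k)"
    and Z: "Z \<in> carrier_mat (Suc j) j" "Z\<^sup>\<dagger> * Z = 1\<^sub>m j" "Z\<^sup>\<dagger> * z = 0\<^sub>m j 1" "Z * Z\<^sup>\<dagger> + z * z\<^sup>\<dagger> = 1\<^sub>m (Suc j)"
    and Y: "Y \<in> carrier_mat (Suc k) k" "Y\<^sup>\<dagger> * Y = 1\<^sub>m k" "Y\<^sup>\<dagger> * y = 0\<^sub>m k 1" "Y * Y\<^sup>\<dagger> + y * y\<^sup>\<dagger> = 1\<^sub>m (Suc k)"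
    and cs: "cs_form p p' N \<theta> a b m l (Z\<^sup>\<dagger> * \<alpha> * W) (Z\<^sup>\<dagger> * T * X) (Y\<^sup>\<dagger> * \<beta> * W) (Y\<^sup>\<dagger> * P * X)"
    and k: "k = p + N" and j: "j = p' + N"
  shows "cs_form p p' (Suc N) (\<theta>(N := t)) (snoc_col (Y * a) y) (snoc_col (X * b) x)
    (snoc_col (Z * m) z) (snoc_col (W * l) w) \<alpha> T \<beta> P"
proof -
  note c = unitary_blocks_carrier[OF A]
  note v = vec[unfolded cs_vectors_def]
  have vc: "w \<in> carrier_mat (Suc j) 1" "x \<in> carrier_mat (Suc k) 1" "z \<in> carrier_mat (Suc j) 1" "y \<in> carrier_mat (Suc k) 1"
    and vn: "col_norm2 w = 1" "col_norm2 x = 1" "col_norm2 z = 1" "col_norm2 y = 1"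
    and r: "\<alpha> * w = cos t \<cdot>\<^sub>r z" "\<alpha>\<^sup>\<dagger> * z = cos t \<cdot>\<^sub>r w" "T * x = (- sin t) \<cdot>\<^sub>r z" "T\<^sup>\<dagger> * z = (- sin t) \<cdot>\<^sub>r x"
      "\<beta> * w = sin t \<cdot>\<^sub>r y" "\<beta>\<^sup>\<dagger> * y = sin t \<cdot>\<^sub>r w" "P * x = cos t \<cdot>\<^sub>r y" "P\<^sup>\<dagger> * y = cos t \<cdot>\<^sub>r x"
    using v by simp_all
  have S: "a \<in> Sp k" "b \<in> Sp k" "m \<in> Sp j" "l \<in> Sp j"
    and D: "Z\<^sup>\<dagger> * \<alpha> * W = m * cs_blk (1\<^sub>m p') N (\<lambda>i. cos (\<theta> i)) * l\<^sup>\<dagger>"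
      "Z\<^sup>\<dagger> * T * X = m * cs_blk (0\<^sub>m p' p) N (\<lambda>i. - sin (\<theta> i)) * b\<^sup>\<dagger>"
      "Y\<^sup>\<dagger> * \<beta> * W = a * cs_blk (0\<^sub>m p p') N (\<lambda>i. sin (\<theta> i)) * l\<^sup>\<dagger>"
      "Y\<^sup>\<dagger> * P * X = a * cs_blk (1\<^sub>m p) N (\<lambda>i. cos (\<theta> i)) * b\<^sup>\<dagger>"
    using cs unfolding cs_form_def k j by simp_all
  note Sc = S[THEN SpD(1)]
  have upd: "(\<lambda>i. g ((\<theta>(N := t)) i)) = (\<lambda>i. g (\<theta> i))(N := g t)" for g :: "real \<Rightarrow> real"
    by (rule ext) simp
  have "\<alpha> = snoc_col (Z * m) z * cs_blk (1\<^sub>m p') (Suc N) ((\<lambda>i. cos (\<theta> i))(N := cos t)) * (snoc_col (W * l) w)\<^sup>\<dagger>"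
    by (rule snoc_col_cs_blk[OF _ Z(1)[unfolded j] Sc(3)[unfolded j] vc(3)[unfolded j] W(1)[unfolded j]
          Sc(4)[unfolded j] vc(1)[unfolded j] compress_split[OF c(1) Z(1) vc(3) W(1) vc(1) Z(4,3) W(4) r(1,2)] D(1)]) simp
  moreover have "T = snoc_col (Z * m) z * cs_blk (0\<^sub>m p' p) (Suc N) ((\<lambda>i. - sin (\<theta> i))(N := - sin t)) * (snoc_col (X * b) x)\<^sup>\<dagger>"
    by (rule snoc_col_cs_blk[OF _ Z(1)[unfolded j] Sc(3)[unfolded j] vc(3)[unfolded j] X(1)[unfolded k]
          Sc(2)[unfolded k] vc(2)[unfolded k] compress_split[OF c(2) Z(1) vc(3) X(1) vc(2) Z(4,3) X(4) r(3,4)] D(2)]) simp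
  moreover have "\<beta> = snoc_col (Y * a) y * cs_blk (0\<^sub>m p p') (Suc N) ((\<lambda>i. sin (\<theta> i))(N := sin t)) * (snoc_col (W * l) w)\<^sup>\<dagger>"
    by (rule snoc_col_cs_blk[OF _ Y(1)[unfolded k] Sc(1)[unfolded k] vc(4)[unfolded k] W(1)[unfolded j]
          Sc(4)[unfolded j] vc(1)[unfolded j] compress_split[OF c(3) Y(1) vc(4) W(1) vc(1) Y(4,3) W(4) r(5,6)] D(3)]) simp
  moreover have "P = snoc_col (Y * a) y * cs_blk (1\<^sub>m p) (Suc N) ((\<lambda>i. cos (\<theta> i))(N := cos t)) * (snoc_col (X * b) x)\<^sup>\<dagger>"
    by (rule snoc_col_cs_blk[OF _ Y(1)[unfolded k] Sc(1)[unfolded k] vc(4)[unfolded k] X(1)[unfolded k]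
          Sc(2)[unfolded k] vc(2)[unfolded k] compress_split[OF c(4) Y(1) vc(4) X(1) vc(2) Y(4,3) X(4) r(7,8)] D(4)]) simp
  moreover have "snoc_col (Y * a) y \<in> Sp (Suc k)" "snoc_col (X * b) x \<in> Sp (Suc k)"
      "snoc_col (Z * m) z \<in> Sp (Suc j)" "snoc_col (W * l) w \<in> Sp (Suc j)"
    using snoc_col_Sp[OF Y(1-3) vc(4) vn(4) S(1)] snoc_col_Sp[OF X(1-3) vc(2) vn(2) S(2)]
      snoc_col_Sp[OF Z(1-3) vc(3) vn(3) S(3)] snoc_col_Sp[OF W(1-3) vc(1) vn(1) S(4)] by this
  ultimately show ?thesis
    unfolding cs_form_def upd[of cos] upd[of sin] upd[of "\<lambda>s. - sin s"] add_Suc_right k[symmetric] j[symmetric]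
    by (intro conjI)
qed

text \<open>
  The clause about injectivity of \<open>P\<close> keeps the right angles at the end: a new angle below
  \<open>\<pi>/2\<close> is only appended when \<open>P\<close> is injective, and then the decomposition of the compressed
  blocks has no right angles yet.
\<close>

lemma cs_form_exists:
  assumes "unitary_blocks j k \<alpha> T \<beta> P"
  shows "\<exists>p p' q r \<theta> a b m l. p + q + r = k \<and> p' + q + r = j \<and>
    (\<forall>i<q. 0 < \<theta> i \<and> \<theta> i < pi / 2) \<and> (\<forall>i. q \<le> i \<and> i < q + r \<longrightarrow> \<theta> i = pi / 2) \<and>
    ((\<forall>u \<in> carrier_mat k 1. P * u = 0\<^sub>m k 1 \<longrightarrow> u = 0\<^sub>m k 1) \<longrightarrow> r = 0) \<and>
    cs_form p p' (q + r) \<theta> a b m l \<alpha> T \<beta> P"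
  using assms
proof (induction k arbitrary: j \<alpha> T \<beta> P)
  case 0
  have "T = 0\<^sub>m j 0" using unitary_blocks_carrier(2)[OF 0] by (intro eq_matI) auto
  from cs_form_of_zero_corner[OF 0 this, of "\<lambda>_. 0"] show ?case
    by - (rule exI[of _ 0], rule exI[of _ j], rule exI[of _ 0], rule exI[of _ 0],
        rule exI[of _ "\<lambda>_. 0"], rule exI[of _ P], rule exI[of _ "1\<^sub>m 0"],
        rule exI[of _ \<alpha>], rule exI[of _ "1\<^sub>m j"], simp)
next
  case (Suc k)
  note A = \<open>unitary_blocks j (Suc k) \<alpha> T \<beta> P\<close>
  show ?case
  proof (cases "T = 0\<^sub>m j (Suc k)")
    case True
    from cs_form_of_zero_corner[OF A this, of "\<lambda>_. 0"] show ?thesis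
      by - (rule exI[of _ "Suc k"], rule exI[of _ j], rule exI[of _ 0], rule exI[of _ 0],
          rule exI[of _ "\<lambda>_. 0"], rule exI[of _ P], rule exI[of _ "1\<^sub>m (Suc k)"],
          rule exI[of _ \<alpha>], rule exI[of _ "1\<^sub>m j"], simp)
  next
    case False
    have "j \<noteq> 0"
    proof
      assume "j = 0"
      then have "T = 0\<^sub>m j (Suc k)" using unitary_blocks_carrier(2)[OF A] by (intro eq_matI) auto
      with False show False by (rule notE)
    qed
    then obtain j' where j: "j = Suc j'" by (cases j) auto
    note A' = A[unfolded j]
    note c = unitary_blocks_carrier[OF A']
    obtain t w x z y where t: "0 < t" "t \<le> pi / 2" and vec: "cs_vectors (Suc j') (Suc k) \<alpha> T \<beta> P t w x z y"
      and inj: "t < pi / 2 \<longrightarrow> (\<forall>u \<in> carrier_mat (Suc k) 1. P * u = 0\<^sub>m (Suc k) 1 \<longrightarrow> u = 0\<^sub>m (Suc k) 1)"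
      using exists_cs_vectors[OF A' False[unfolded j]] by (elim exE conjE)
    note v = vec[unfolded cs_vectors_def]
    have vc: "w \<in> carrier_mat (Suc j') 1" "x \<in> carrier_mat (Suc k) 1" "z \<in> carrier_mat (Suc j') 1" "y \<in> carrier_mat (Suc k) 1"
      and vn: "col_norm2 w = 1" "col_norm2 x = 1" "col_norm2 z = 1" "col_norm2 y = 1"
      and r: "\<alpha> * w = cos t \<cdot>\<^sub>r z" "T * x = (- sin t) \<cdot>\<^sub>r z" "\<beta> * w = sin t \<cdot>\<^sub>r y" "P * x = cos t \<cdot>\<^sub>r y"
        "P\<^sup>\<dagger> * y = cos t \<cdot>\<^sub>r x"
      using v by simp_all
    obtain W where W: "W \<in> carrier_mat (Suc j') j'" "W\<^sup>\<dagger> * W = 1\<^sub>m j'" "W\<^sup>\<dagger> * w = 0\<^sub>m j' 1" "W * W\<^sup>\<dagger> + w * w\<^sup>\<dagger> = 1\<^sub>m (Suc j')"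
      using unitary_completion[OF vc(1) vn(1)] by (elim bexE conjE)
    obtain X where X: "X \<in> carrier_mat (Suc k) k" "X\<^sup>\<dagger> * X = 1\<^sub>m k" "X\<^sup>\<dagger> * x = 0\<^sub>m k 1" "X * X\<^sup>\<dagger> + x * x\<^sup>\<dagger> = 1\<^sub>m (Suc k)"
      using unitary_completion[OF vc(2) vn(2)] by (elim bexE conjE)
    obtain Z where Z: "Z \<in> carrier_mat (Suc j') j'" "Z\<^sup>\<dagger> * Z = 1\<^sub>m j'" "Z\<^sup>\<dagger> * z = 0\<^sub>m j' 1" "Z * Z\<^sup>\<dagger> + z * z\<^sup>\<dagger> = 1\<^sub>m (Suc j')"
      using unitary_completion[OF vc(3) vn(3)] by (elim bexE conjE)
    obtain Y where Y: "Y \<in> carrier_mat (Suc k) k" "Y\<^sup>\<dagger> * Y = 1\<^sub>m k" "Y\<^sup>\<dagger> * y = 0\<^sub>m k 1" "Y * Y\<^sup>\<dagger> + y * y\<^sup>\<dagger> = 1\<^sub>m (Suc k)"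
      using unitary_completion[OF vc(4) vn(4)] by (elim bexE conjE)
    have "unitary_blocks j' k (Z\<^sup>\<dagger> * \<alpha> * W) (Z\<^sup>\<dagger> * T * X) (Y\<^sup>\<dagger> * \<beta> * W) (Y\<^sup>\<dagger> * P * X)"
      by (rule compress_unitary_blocks[OF A' vc(3) Z(1,3,2) vc(1) W(1,4) vc(2) X(1,4) vc(4) Y(1,3,2) r(1-4)])
    from Suc.IH[OF this] obtain p p' q r' \<theta> a b m l where
      dims: "p + q + r' = k" "p' + q + r' = j'" and \<theta>: "\<forall>i<q. 0 < \<theta> i \<and> \<theta> i < pi / 2"
        "\<forall>i. q \<le> i \<and> i < q + r' \<longrightarrow> \<theta> i = pi / 2"
      and inj': "(\<forall>u \<in> carrier_mat k 1. Y\<^sup>\<dagger> * P * X * u = 0\<^sub>m k 1 \<longrightarrow> u = 0\<^sub>m k 1) \<longrightarrow> r' = 0"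
      and cs: "cs_form p p' (q + r') \<theta> a b m l (Z\<^sup>\<dagger> * \<alpha> * W) (Z\<^sup>\<dagger> * T * X) (Y\<^sup>\<dagger> * \<beta> * W) (Y\<^sup>\<dagger> * P * X)"
      by (elim exE conjE)
    have kj: "k = p + (q + r')" "j' = p' + (q + r')" using dims by simp_all
    note ext = cs_form_extend[OF A' vec W X Z Y cs kj]
    show ?thesis
    proof (cases "t < pi / 2")
      case True
      have P_inj: "u = 0\<^sub>m (Suc k) 1" if "u \<in> carrier_mat (Suc k) 1" "P * u = 0\<^sub>m (Suc k) 1" for u
        by (rule inj[THEN mp, OF True, THEN bspec, THEN mp, OF that])
      have comp_inj: "u = 0\<^sub>m k 1" if u: "u \<in> carrier_mat k 1" "Y\<^sup>\<dagger> * P * X * u = 0\<^sub>m k 1" for u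
      proof -
        note split = compress_split[OF c(4) Y(1) vc(4) X(1) vc(2) Y(4,3) X(4) r(4,5)]
        have xX: "x\<^sup>\<dagger> * X = 0\<^sub>m 1 k"
        proof -
          have "x\<^sup>\<dagger> * X = (X\<^sup>\<dagger> * x)\<^sup>\<dagger>" using X(1) vc(2) by (subst conj_transpose_mult) auto
          then show ?thesis by (simp add: X(3))
        qed
        \<comment> \<open>A kernel column \<open>u\<close> of the compression gives the kernel column \<open>X u\<close> of \<open>P\<close>, because
          \<open>X u\<close> is orthogonal to \<open>x\<close>.\<close>
        have "P * (X * u) = (Y * (Y\<^sup>\<dagger> * P * X) * X\<^sup>\<dagger> + cos t \<cdot>\<^sub>r (y * x\<^sup>\<dagger>)) * (X * u)"
          by (rule arg_cong[where f = "\<lambda>M. M * (X * u)", OF split])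
        also have "\<dots> = Y * (Y\<^sup>\<dagger> * P * X * (X\<^sup>\<dagger> * X * u)) + cos t \<cdot>\<^sub>r (y * (x\<^sup>\<dagger> * X * u))"
          using X(1) Y(1) vc(2,4) c(4) u(1) by (simp add: mat_algebra)
        also have "\<dots> = Y * (Y\<^sup>\<dagger> * P * X * u) + cos t \<cdot>\<^sub>r (y * 0\<^sub>m 1 1)"
          unfolding X(2) xX using u(1) by simp
        also have "\<dots> = 0\<^sub>m (Suc k) 1"
          unfolding u(2) using Y(1) vc(4) by simp
        finally have "X * u = 0\<^sub>m (Suc k) 1"
          by (rule P_inj[OF mult_carrier_mat[OF X(1) u(1)]])
        then have "X\<^sup>\<dagger> * (X * u) = 0\<^sub>m k 1" using X(1) by simp
        moreover have "X\<^sup>\<dagger> * X * u = X\<^sup>\<dagger> * (X * u)" using X(1) u(1) by (intro mat_mult_assoc) auto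
        ultimately show ?thesis using u(1) unfolding X(2) by simp
      qed
      have "\<forall>u \<in> carrier_mat k 1. Y\<^sup>\<dagger> * P * X * u = 0\<^sub>m k 1 \<longrightarrow> u = 0\<^sub>m k 1"
        by (intro ballI impI) (rule comp_inj; assumption)
      with inj' have "r' = 0" by (rule mp)
      have "p + Suc q + 0 = Suc k" "p' + Suc q + 0 = j" using dims \<open>r' = 0\<close> j by simp_all
      moreover have "\<forall>i<Suc q. 0 < (\<theta>(q + r' := t)) i \<and> (\<theta>(q + r' := t)) i < pi / 2"
        using \<theta>(1) t True \<open>r' = 0\<close> by (simp add: less_Suc_eq)
      moreover have "\<forall>i. Suc q \<le> i \<and> i < Suc q + 0 \<longrightarrow> (\<theta>(q + r' := t)) i = pi / 2" by simp
      moreover have "(\<forall>u \<in> carrier_mat (Suc k) 1. P * u = 0\<^sub>m (Suc k) 1 \<longrightarrow> u = 0\<^sub>m (Suc k) 1) \<longrightarrow> (0::nat) = 0"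
        by (intro impI refl)
      moreover have "Suc q + 0 = Suc (q + r')" using \<open>r' = 0\<close> by simp
      note ext[folded this]
      ultimately show ?thesis
        by - (rule exI[of _ p], rule exI[of _ p'], rule exI[of _ "Suc q"], rule exI[of _ 0],
            rule exI[of _ "\<theta>(q + r' := t)"], rule exI[of _ "snoc_col (Y * a) y"],
            rule exI[of _ "snoc_col (X * b) x"], rule exI[of _ "snoc_col (Z * m) z"],
            rule exI[of _ "snoc_col (W * l) w"], intro conjI)
    next
      case False
      then have tp: "t = pi / 2" using t(2) by simp
      have Px: "P * x = 0\<^sub>m (Suc k) 1"
        unfolding r(4) tp using smult_real_0[OF vc(4)] by simp
      have x0: "x \<noteq> 0\<^sub>m (Suc k) 1"
        using col_norm2_eq_0_iff[OF vc(2)] vn(2) by simp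
      have "\<not> (\<forall>u \<in> carrier_mat (Suc k) 1. P * u = 0\<^sub>m (Suc k) 1 \<longrightarrow> u = 0\<^sub>m (Suc k) 1)"
      proof
        assume "\<forall>u \<in> carrier_mat (Suc k) 1. P * u = 0\<^sub>m (Suc k) 1 \<longrightarrow> u = 0\<^sub>m (Suc k) 1"
        from x0 this[THEN bspec, THEN mp, OF vc(2) Px] show False by (rule notE)
      qed
      then have "(\<forall>u \<in> carrier_mat (Suc k) 1. P * u = 0\<^sub>m (Suc k) 1 \<longrightarrow> u = 0\<^sub>m (Suc k) 1) \<longrightarrow> Suc r' = 0"
        by (rule impI[OF notE])
      moreover have "p + q + Suc r' = Suc k" "p' + q + Suc r' = j" using dims j by simp_all
      moreover have "\<forall>i<q. 0 < (\<theta>(q + r' := t)) i \<and> (\<theta>(q + r' := t)) i < pi / 2"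
        using \<theta>(1) by simp
      moreover have "\<forall>i. q \<le> i \<and> i < q + Suc r' \<longrightarrow> (\<theta>(q + r' := t)) i = pi / 2"
        using \<theta>(2) tp by (simp add: less_Suc_eq)
      moreover note ext[folded add_Suc_right]
      ultimately show ?thesis
        by - (rule exI[of _ p], rule exI[of _ p'], rule exI[of _ q], rule exI[of _ "Suc r'"],
            rule exI[of _ "\<theta>(q + r' := t)"], rule exI[of _ "snoc_col (Y * a) y"],
            rule exI[of _ "snoc_col (X * b) x"], rule exI[of _ "snoc_col (Z * m) z"],
            rule exI[of _ "snoc_col (W * l) w"], intro conjI)
    qed
  qed
qed

theorem theorem3p1:
  fixes k n :: nat and A :: "quat mat"
  assumes "1 \<le> k" and "k \<le> n" and "A \<in> Sp n"
  shows "\<exists>(p::nat) (q::nat) (r::nat) (p'::nat) (\<theta> :: nat \<Rightarrow> real)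
           (a :: quat mat) (b :: quat mat) (m :: quat mat) (l :: quat mat)
           (\<alpha> :: quat mat) (T :: quat mat) (\<beta> :: quat mat) (P :: quat mat).
      int p \<ge> 2 * int k - int n \<and> p + q + r = k \<and> p' + q + r = n - k \<and>
      (\<forall>i<q. 0 < \<theta> i \<and> \<theta> i < pi / 2) \<and>
      a \<in> Sp k \<and> b \<in> Sp k \<and> m \<in> Sp (n - k) \<and> l \<in> Sp (n - k) \<and>
      \<alpha> \<in> carrier_mat (n - k) (n - k) \<and> T \<in> carrier_mat (n - k) k \<and>
      \<beta> \<in> carrier_mat k (n - k) \<and> P \<in> carrier_mat k k \<and>
      A = four_block_mat \<alpha> T \<beta> P \<and>
      \<alpha> = m * diag_block_mat [1\<^sub>m p', mat_diag q (\<lambda>i. of_real (cos (\<theta> i))), 0\<^sub>m r r]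
            * conj_transpose l \<and>
      T = m * diag_block_mat [0\<^sub>m p' p, - mat_diag q (\<lambda>i. of_real (sin (\<theta> i))), - 1\<^sub>m r]
            * conj_transpose b \<and>
      \<beta> = a * diag_block_mat [0\<^sub>m p p', mat_diag q (\<lambda>i. of_real (sin (\<theta> i))), 1\<^sub>m r]
            * conj_transpose l \<and>
      P = a * diag_block_mat [1\<^sub>m p, mat_diag q (\<lambda>i. of_real (cos (\<theta> i))), 0\<^sub>m r r]
            * conj_transpose b"
proof -
  obtain \<alpha> T \<beta> P where split: "split_block A (n - k) (n - k) = (\<alpha>, T, \<beta>, P)"
    by (rule prod_cases4)
  have "dim_row A = (n - k) + k" "dim_col A = (n - k) + k"
    using SpD(1)[OF assms(3)] \<open>k \<le> n\<close> by auto
  note blocks = split_block[OF split this]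
  have "unitary_blocks (n - k) k \<alpha> T \<beta> P"
    using blocks assms unfolding unitary_blocks_def by simp
  from cs_form_exists[OF this] obtain p p' q r \<theta> a b m l where
    dims: "p + q + r = k" "p' + q + r = n - k" and \<theta>: "\<forall>i<q. 0 < \<theta> i \<and> \<theta> i < pi / 2"
      and \<theta>': "\<forall>i. q \<le> i \<and> i < q + r \<longrightarrow> \<theta> i = pi / 2"
      and cs: "cs_form p p' (q + r) \<theta> a b m l \<alpha> T \<beta> P"
    by (elim exE conjE)
  have kj: "p + (q + r) = k" "p' + (q + r) = n - k" using dims by simp_all
  \<comment> \<open>At a right angle the cosine and sine are 0 and 1, the entries of the last blocks.\<close>
  have th: "\<theta> (q + i) = pi / 2" if "i < r" for i using \<theta>' that by simp
  have C: "diag_block_mat [E, mat_diag q (\<lambda>i. of_real (cos (\<theta> i))), 0\<^sub>m r r] = cs_blk E (q + r) (\<lambda>i. cos (\<theta> i))" for E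
    by (rule diag_block_mat_eq_cs_blk) (auto simp: mat_diag_def th intro!: eq_matI)
  have S: "diag_block_mat [E, mat_diag q (\<lambda>i. of_real (sin (\<theta> i))), 1\<^sub>m r] = cs_blk E (q + r) (\<lambda>i. sin (\<theta> i))" for E
    by (rule diag_block_mat_eq_cs_blk) (auto simp: mat_diag_def th intro!: eq_matI)
  have S': "diag_block_mat [E, - mat_diag q (\<lambda>i. of_real (sin (\<theta> i))), - 1\<^sub>m r] = cs_blk E (q + r) (\<lambda>i. - sin (\<theta> i))" for E
    by (rule diag_block_mat_eq_cs_blk) (auto simp: mat_diag_def th intro!: eq_matI)
  have "int p \<ge> 2 * int k - int n" using dims \<open>k \<le> n\<close> by linarith
  then show ?thesis
    using cs[unfolded cs_form_def kj] blocks dims \<theta>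
    by - (rule exI[of _ p], rule exI[of _ q], rule exI[of _ r], rule exI[of _ p'],
        rule exI[of _ \<theta>], rule exI[of _ a], rule exI[of _ b], rule exI[of _ m],
        rule exI[of _ l], rule exI[of _ \<alpha>], rule exI[of _ T], rule exI[of _ \<beta>],
        rule exI[of _ P], unfold C S S', intro conjI, (elim conjE, assumption)+)
qed

end
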